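(* Let $(\mathcal{A},\Delta)$ be a Hopf algebra over $\mathbb{C}$, let $\mathcal{E}$ be a finite bicovariant $\mathcal{A}$-bimodule, and let $g$ be a left-invariant pseudo-Riemannian metric on $\mathcal{E}$. Fix a basis $\{\omega_1,\dots,\omega_n\}$ of ${}_0\mathcal{E}$, put $g_{ij}=g(\omega_i\otimes_{\mathcal{A}}\omega_j)$, and let $V_g:\mathcal{E}\to\mathcal{E}^*=\mathrm{Hom}_{\mathcal{A}}(\mathcal{E},\mathcal{A})$ be $V_g(e)(f)=g(e\otimes_{\mathcal{A}}f)$. Then: (i) $V_g$ is a one-one right $\mathcal{A}$-linear map from $\mathcal{E}$ to $\mathcal{E}^*$. (ii) If $e\in\mathcal{E}$ satisfies $g(e\otimes_{\mathcal{A}}f)=0$ for all $f\in{}_0\mathcal{E}$, then $e=0$. In particular, the map $V_g|_{{}_0\mathcal{E}}$ is one-one and hence an isomorphism from ${}_0\mathcal{E}$ to $({}_0\mathcal{E})^*$. (iii) The matrix $((g_{ij}))_{ij}$ is invertible. (iv) If $g^{ij}$ denotes the $(i,j)$-th entry of the inverse of the matrix $((g_{ij}))_{ij}$, then $g^{ij}\in\mathbb{C}\cdot1$ for all $i,j$. (v) If $f\in\mathcal{E}$ satisfies $g(e\otimes_{\mathcal{A}}f)=0$ for all $e\in{}_0\mathcal{E}$, then $f=0$.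
   Context: All vector spaces are over $\mathbb{C}$; $\epsilon$ is the counit. Left coactions are written $\Delta_M(m)=m_{(-1)}\otimes m_{(0)}\in\mathcal{A}\otimes_{\mathbb{C}}M$ and right coactions ${}_M\Delta(m)=m_{(0)}\otimes m_{(1)}\in M\otimes_{\mathbb{C}}\mathcal{A}$. Bicovariant bimodule $(M,\Delta_M,{}_M\Delta)$: an $\mathcal{A}$-bimodule that is a left and a right $\mathcal{A}$-comodule with $(\mathrm{id}\otimes{}_M\Delta)\Delta_M=(\Delta_M\otimes\mathrm{id}){}_M\Delta$ and $\Delta_M(am)=\Delta(a)\Delta_M(m)$, $\Delta_M(ma)=\Delta_M(m)\Delta(a)$, ${}_M\Delta(am)=\Delta(a){}_M\Delta(m)$, ${}_M\Delta(ma)={}_M\Delta(m)\Delta(a)$. ${}_0M=\{m:\Delta_M(m)=1\otimes m\}$, $M_0=\{m:{}_M\Delta(m)=m\otimes1\}$; $M$ is finite if $\dim_{\mathbb{C}}{}_0M<\infty$. The multiplication maps ${}_0M\otimes\mathcal{A}\to M$, $\mathcal{A}\otimes{}_0M\to M$, $M_0\otimes\mathcal{A}\to M$, $\mathcal{A}\otimes M_0\to M$ are taken as known to be isomorphisms. $\Delta_{M\otimes_{\mathcal{A}}N}(m\otimes n)=m_{(-1)}n_{(-1)}\otimes m_{(0)}\otimes_{\mathcal{A}}n_{(0)}$. Braiding (Woronowicz, known): $\sigma:\mathcal{E}\otimes_{\mathcal{A}}\mathcal{E}\to\mathcal{E}\otimes_{\mathcal{A}}\mathcal{E}$ is the unique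 $\mathcal{A}$-bimodule map with $\sigma(\omega\otimes_{\mathcal{A}}\eta)=\eta\otimes_{\mathcal{A}}\omega$ for $\omega\in{}_0\mathcal{E}$, $\eta\in\mathcal{E}_0$. A pseudo-Riemannian metric on $\mathcal{E}$ is a right $\mathcal{A}$-linear map $g:\mathcal{E}\otimes_{\mathcal{A}}\mathcal{E}\to\mathcal{A}$ with (i) $g\circ\sigma=g$; (ii) if $g(\rho\otimes_{\mathcal{A}}\nu)=0$ for all $\nu\in\mathcal{E}$ then $\rho=0$. It is left-invariant if $(\mathrm{id}\otimes\epsilon g)\Delta_{\mathcal{E}\otimes_{\mathcal{A}}\mathcal{E}}(\rho\otimes_{\mathcal{A}}\nu)=g(\rho\otimes_{\mathcal{A}}\nu)$ for all $\rho,\nu\in\mathcal{E}$. For such $g$, it is known that $g(\omega\otimes_{\mathcal{A}}\omega')\in\mathbb{C}\cdot1$ for $\omega,\omega'\in{}_0\mathcal{E}$. $\mathcal{E}^*$ is the set of right $\mathcal{A}$-linear maps $\mathcal{E}\to\mathcal{A}$, with right $\mathcal{A}$-action $(\phi a)(e)=\phi(ae)$. $({}_0\mathcal{E})^*=\mathrm{Hom}_{\mathbb{C}}({}_0\mathcal{E},\mathbb{C})$, and in (ii) $V_g(e)$, for $e\in{}_0\mathcal{E}$, is regarded as an element of $({}_0\mathcal{E})^*$ by restriction to ${}_0\mathcal{E}$ (with $\mathbb{C}\cdot1\cong\mathbb{C}$). *)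

theory Defs
  imports
    Complex_Main
    "HOL-Library.Set_Algebras"
    "HOL-Library.Poly_Mapping"
    "HOL-Library.FuncSet"
    "Jordan_Normal_Form.Matrix"
begin

section \<open>Complex vector spaces and complex algebras\<close>

class scaleC =
  fixes scaleC :: "complex \<Rightarrow> 'a \<Rightarrow> 'a"  (infixr \<open>*\<^sub>C\<close> 75)

class complex_vector = scaleC + ab_group_add +
  assumes scaleC_add_right: "c *\<^sub>C (x + y) = c *\<^sub>C x + c *\<^sub>C y"
    and scaleC_add_left: "(c + d) *\<^sub>C x = c *\<^sub>C x + d *\<^sub>C x"
    and scaleC_scaleC: "c *\<^sub>C (d *\<^sub>C x) = (c * d) *\<^sub>C x"
    and scaleC_one: "1 *\<^sub>C x = x"

text \<open>Unital associative algebras over the complex numbers, not necessarily commutative.\<close>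

class complex_algebra_1 = complex_vector + ring_1 +
  assumes mult_scaleC_left: "(c *\<^sub>C x) * y = c *\<^sub>C (x * y)"
    and mult_scaleC_right: "x * (c *\<^sub>C y) = c *\<^sub>C (x * y)"

interpretation complex_vector: vector_space "scaleC :: complex \<Rightarrow> 'a \<Rightarrow> 'a::complex_vector"
  by unfold_locales (fact scaleC_add_right scaleC_add_left scaleC_scaleC scaleC_one)+

instantiation complex :: complex_algebra_1
begin
definition scaleC_complex :: "complex \<Rightarrow> complex \<Rightarrow> complex"
  where "scaleC_complex c x = c * x"
instance by standard (simp_all add: scaleC_complex_def algebra_simps)
end

abbreviation clinear :: "('a::complex_vector \<Rightarrow> 'b::complex_vector) \<Rightarrow> bool"
  where "clinear \<equiv> Vector_Spaces.linear scaleC scaleC"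

definition cbilinear ::
    "('a::complex_vector \<Rightarrow> 'b::complex_vector \<Rightarrow> 'c::complex_vector) \<Rightarrow> bool"
  where "cbilinear f \<longleftrightarrow> (\<forall>x. clinear (f x)) \<and> (\<forall>y. clinear (\<lambda>x. f x y))"

definition scalars :: "'a::complex_algebra_1 set"
  where "scalars = range (\<lambda>c. c *\<^sub>C 1)"

text \<open>The identification of \<open>scalars\<close> with the complex numbers.\<close>

definition scalar_of :: "'a::complex_algebra_1 \<Rightarrow> complex"
  where "scalar_of a = (THE c. a = c *\<^sub>C 1)"


section \<open>Tensor products over the complex numbers\<close>

text \<open>The free complex vector space on a set of pairs is the type of finitely supported
  functions; the tensor product is its quotient by the bilinearity relations.\<close>

definition free_scale :: "complex \<Rightarrow> ('i \<Rightarrow>\<^sub>0 complex) \<Rightarrow> ('i \<Rightarrow>\<^sub>0 complex)"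
  where "free_scale c p = Poly_Mapping.map ((*) c) p"

lemma lookup_free_scale: "Poly_Mapping.lookup (free_scale c p) i = c * Poly_Mapping.lookup p i"
  by (simp add: free_scale_def Poly_Mapping.map.rep_eq when_def)

interpretation free: vector_space "free_scale :: complex \<Rightarrow> ('i \<Rightarrow>\<^sub>0 complex) \<Rightarrow> ('i \<Rightarrow>\<^sub>0 complex)"
  by unfold_locales
    (rule poly_mapping_eqI; simp add: lookup_free_scale lookup_add algebra_simps)+

abbreviation gen :: "'m \<Rightarrow> 'n \<Rightarrow> ('m \<times> 'n \<Rightarrow>\<^sub>0 complex)"
  where "gen m n \<equiv> Poly_Mapping.single (m, n) 1"

definition bilinearity_relators :: "('m::complex_vector \<times> 'n::complex_vector \<Rightarrow>\<^sub>0 complex) set"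
  where "bilinearity_relators =
    {gen (m + m') n - gen m n - gen m' n | m m' n. True} \<union>
    {gen m (n + n') - gen m n - gen m n' | m n n'. True} \<union>
    {gen (c *\<^sub>C m) n - free_scale c (gen m n) | c m n. True} \<union>
    {gen m (c *\<^sub>C n) - free_scale c (gen m n) | c m n. True}"

definition tensor_rel ::
    "('m::complex_vector \<times> 'n::complex_vector \<Rightarrow>\<^sub>0 complex) \<Rightarrow> ('m \<times> 'n \<Rightarrow>\<^sub>0 complex) \<Rightarrow> bool"
  where "tensor_rel p q \<longleftrightarrow> p - q \<in> free.span bilinearity_relators"

lemma equivp_tensor_rel:
  "equivp (tensor_rel :: ('m::complex_vector \<times> 'n::complex_vector \<Rightarrow>\<^sub>0 complex) \<Rightarrow> _)"
  (is "equivp ?R")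
proof (rule equivpI)
  show "reflp ?R"
    by (rule reflpI) (simp add: tensor_rel_def free.span_zero)
  show "symp ?R"
  proof (rule sympI)
    fix p q :: "'m \<times> 'n \<Rightarrow>\<^sub>0 complex" assume "tensor_rel p q"
    then have "- (p - q) \<in> free.span bilinearity_relators"
      unfolding tensor_rel_def by (rule free.span_neg)
    then show "tensor_rel q p" by (simp add: tensor_rel_def)
  qed
  show "transp ?R"
  proof (rule transpI)
    fix p q r :: "'m \<times> 'n \<Rightarrow>\<^sub>0 complex" assume "tensor_rel p q" "tensor_rel q r"
    then have "(p - q) + (q - r) \<in> free.span bilinearity_relators"
      unfolding tensor_rel_def by (rule free.span_add)
    then show "tensor_rel p r" by (simp add: tensor_rel_def)
  qed
qed

quotient_type (overloaded) ('m, 'n) tensor =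
    "'m::complex_vector \<times> 'n::complex_vector \<Rightarrow>\<^sub>0 complex" / tensor_rel
  by (rule equivp_tensor_rel)

instantiation tensor :: (complex_vector, complex_vector) complex_vector
begin

lift_definition zero_tensor :: "('a, 'b) tensor" is 0 .

lift_definition plus_tensor :: "('a, 'b) tensor \<Rightarrow> ('a, 'b) tensor \<Rightarrow> ('a, 'b) tensor" is "(+)"
proof -
  fix p p' q q' :: "'a \<times> 'b \<Rightarrow>\<^sub>0 complex"
  assume "tensor_rel p p'" "tensor_rel q q'"
  then have "(p - p') + (q - q') \<in> free.span bilinearity_relators"
    unfolding tensor_rel_def by (rule free.span_add)
  then show "tensor_rel (p + q) (p' + q')" by (simp add: tensor_rel_def algebra_simps)
qed

lift_definition uminus_tensor :: "('a, 'b) tensor \<Rightarrow> ('a, 'b) tensor" is uminus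
proof -
  fix p p' :: "'a \<times> 'b \<Rightarrow>\<^sub>0 complex" assume "tensor_rel p p'"
  then have "- (p - p') \<in> free.span bilinearity_relators"
    unfolding tensor_rel_def by (rule free.span_neg)
  then show "tensor_rel (- p) (- p')" by (simp add: tensor_rel_def)
qed

definition minus_tensor :: "('a, 'b) tensor \<Rightarrow> ('a, 'b) tensor \<Rightarrow> ('a, 'b) tensor"
  where "minus_tensor x y = x + - y"

lift_definition scaleC_tensor :: "complex \<Rightarrow> ('a, 'b) tensor \<Rightarrow> ('a, 'b) tensor" is free_scale
proof -
  fix c and p p' :: "'a \<times> 'b \<Rightarrow>\<^sub>0 complex" assume "tensor_rel p p'"
  then have "free_scale c (p - p') \<in> free.span bilinearity_relators"
    unfolding tensor_rel_def by (rule free.span_scale)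
  then show "tensor_rel (free_scale c p) (free_scale c p')"
    by (simp add: tensor_rel_def free.scale_right_diff_distrib)
qed

instance
proof
  fix x y z :: "('a, 'b) tensor" and c d :: complex
  show "x + y + z = x + (y + z)"
    by transfer (simp add: tensor_rel_def free.span_zero algebra_simps)
  show "x + y = y + x"
    by transfer (simp add: tensor_rel_def free.span_zero algebra_simps)
  show "0 + x = x"
    by transfer (simp add: tensor_rel_def free.span_zero)
  show "- x + x = 0"
    by transfer (simp add: tensor_rel_def free.span_zero)
  show "x - y = x + - y"
    by (rule minus_tensor_def)
  show "c *\<^sub>C (x + y) = c *\<^sub>C x + c *\<^sub>C y"
    by transfer (simp add: tensor_rel_def free.span_zero free.scale_right_distrib)
  show "(c + d) *\<^sub>C x = c *\<^sub>C x + d *\<^sub>C x"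
    by transfer (simp add: tensor_rel_def free.span_zero free.scale_left_distrib)
  show "c *\<^sub>C (d *\<^sub>C x) = (c * d) *\<^sub>C x"
    by transfer (simp add: tensor_rel_def free.span_zero)
  show "1 *\<^sub>C x = x"
    by transfer (simp add: tensor_rel_def free.span_zero)
qed

end

lift_definition tensor :: "'a::complex_vector \<Rightarrow> 'b::complex_vector \<Rightarrow> ('a, 'b) tensor"
    (infixl \<open>\<otimes>\<^sub>\<complex>\<close> 72)
  is gen .

text \<open>The linear map induced by a bilinear map \<open>f\<close>. It is evaluated on an arbitrary
  representative, hence meaningful only for bilinear \<open>f\<close>; the universal property is
  proved below.\<close>

definition tensor_lift ::
    "('a::complex_vector \<Rightarrow> 'b::complex_vector \<Rightarrow> 'c::complex_vector) \<Rightarrow> ('a, 'b) tensor \<Rightarrow> 'c"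
  where "tensor_lift f x =
    (let p = rep_tensor x in \<Sum>(a, b)\<in>Poly_Mapping.keys p. Poly_Mapping.lookup p (a, b) *\<^sub>C f a b)"

definition tensor_map ::
    "('a::complex_vector \<Rightarrow> 'c::complex_vector) \<Rightarrow> ('b::complex_vector \<Rightarrow> 'd::complex_vector)
      \<Rightarrow> ('a, 'b) tensor \<Rightarrow> ('c, 'd) tensor"
  where "tensor_map f g = tensor_lift (\<lambda>a b. f a \<otimes>\<^sub>\<complex> g b)"

text \<open>The componentwise product of two tensors:
  \<open>(a \<otimes> b, c \<otimes> d) \<mapsto> f a c \<otimes> g b d\<close>.\<close>

definition tensor_map2 ::
    "('a::complex_vector \<Rightarrow> 'c::complex_vector \<Rightarrow> 'e::complex_vector)
      \<Rightarrow> ('b::complex_vector \<Rightarrow> 'd::complex_vector \<Rightarrow> 'f::complex_vector)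
      \<Rightarrow> ('a, 'b) tensor \<Rightarrow> ('c, 'd) tensor \<Rightarrow> ('e, 'f) tensor"
  where "tensor_map2 f g x y =
    tensor_lift (\<lambda>a b. tensor_lift (\<lambda>c d. f a c \<otimes>\<^sub>\<complex> g b d) y) x"

definition tensor_assoc ::
    "(('a::complex_vector, 'b::complex_vector) tensor, 'c::complex_vector) tensor
      \<Rightarrow> ('a, ('b, 'c) tensor) tensor"
  where "tensor_assoc = tensor_lift (\<lambda>x c. tensor_lift (\<lambda>a b. a \<otimes>\<^sub>\<complex> (b \<otimes>\<^sub>\<complex> c)) x)"

text \<open>For subspaces \<open>U\<close> and \<open>V\<close>, the tensor product of \<open>U\<close> and \<open>V\<close>, embedded in the
  tensor product of the ambient spaces (over a field this embedding is injective).\<close>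

definition tensor_of_subspaces ::
    "'a::complex_vector set \<Rightarrow> 'b::complex_vector set \<Rightarrow> ('a, 'b) tensor set"
  where "tensor_of_subspaces U V = complex_vector.span {u \<otimes>\<^sub>\<complex> v | u v. u \<in> U \<and> v \<in> V}"


section \<open>Hopf algebras and bicovariant bimodules\<close>

record (overloaded) 'a hopf_data =
  comult :: "'a \<Rightarrow> ('a, 'a) tensor"
  counit :: "'a \<Rightarrow> complex"
  antipode :: "'a \<Rightarrow> 'a"

definition hopf_algebra :: "'a::complex_algebra_1 hopf_data \<Rightarrow> bool"
  where "hopf_algebra H \<longleftrightarrow>
    clinear (comult H) \<and> clinear (counit H) \<and> clinear (antipode H) \<and>
    \<comment> \<open>coalgebra\<close>
    (\<forall>a. tensor_assoc (tensor_map (comult H) id (comult H a))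
        = tensor_map id (comult H) (comult H a)) \<and>
    (\<forall>a. tensor_lift (\<lambda>x y. counit H x *\<^sub>C y) (comult H a) = a) \<and>
    (\<forall>a. tensor_lift (\<lambda>x y. counit H y *\<^sub>C x) (comult H a) = a) \<and>
    \<comment> \<open>comultiplication and counit are unital algebra homomorphisms\<close>
    (\<forall>a b. comult H (a * b) = tensor_map2 (*) (*) (comult H a) (comult H b)) \<and>
    comult H 1 = 1 \<otimes>\<^sub>\<complex> 1 \<and>
    (\<forall>a b. counit H (a * b) = counit H a * counit H b) \<and>
    counit H 1 = 1 \<and>
    \<comment> \<open>antipode\<close>
    (\<forall>a. tensor_lift (\<lambda>x y. antipode H x * y) (comult H a) = counit H a *\<^sub>C 1) \<and>
    (\<forall>a. tensor_lift (\<lambda>x y. x * antipode H y) (comult H a) = counit H a *\<^sub>C 1)"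

record (overloaded) ('a, 'm) bimod_data =
  lact :: "'a \<Rightarrow> 'm \<Rightarrow> 'm"
  ract :: "'m \<Rightarrow> 'a \<Rightarrow> 'm"
  lcoact :: "'m \<Rightarrow> ('a, 'm) tensor"
  rcoact :: "'m \<Rightarrow> ('m, 'a) tensor"

definition bimodule :: "('a::complex_algebra_1, 'm::complex_vector) bimod_data \<Rightarrow> bool"
  where "bimodule M \<longleftrightarrow>
    cbilinear (lact M) \<and> cbilinear (ract M) \<and>
    (\<forall>m. lact M 1 m = m) \<and> (\<forall>a b m. lact M (a * b) m = lact M a (lact M b m)) \<and>
    (\<forall>m. ract M m 1 = m) \<and> (\<forall>a b m. ract M m (a * b) = ract M (ract M m a) b) \<and>
    (\<forall>a b m. ract M (lact M a m) b = lact M a (ract M m b))"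

definition left_comodule ::
    "'a::complex_algebra_1 hopf_data \<Rightarrow> ('a, 'm::complex_vector) bimod_data \<Rightarrow> bool"
  where "left_comodule H M \<longleftrightarrow>
    clinear (lcoact M) \<and>
    (\<forall>m. tensor_assoc (tensor_map (comult H) id (lcoact M m))
        = tensor_map id (lcoact M) (lcoact M m)) \<and>
    (\<forall>m. tensor_lift (\<lambda>a n. counit H a *\<^sub>C n) (lcoact M m) = m)"

definition right_comodule ::
    "'a::complex_algebra_1 hopf_data \<Rightarrow> ('a, 'm::complex_vector) bimod_data \<Rightarrow> bool"
  where "right_comodule H M \<longleftrightarrow>
    clinear (rcoact M) \<and>
    (\<forall>m. tensor_assoc (tensor_map (rcoact M) id (rcoact M m))
        = tensor_map id (comult H) (rcoact M m)) \<and>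
    (\<forall>m. tensor_lift (\<lambda>n a. counit H a *\<^sub>C n) (rcoact M m) = m)"

definition bicovariant_bimodule ::
    "'a::complex_algebra_1 hopf_data \<Rightarrow> ('a, 'm::complex_vector) bimod_data \<Rightarrow> bool"
  where "bicovariant_bimodule H M \<longleftrightarrow>
    bimodule M \<and> left_comodule H M \<and> right_comodule H M \<and>
    (\<forall>m. tensor_map id (rcoact M) (lcoact M m)
        = tensor_assoc (tensor_map (lcoact M) id (rcoact M m))) \<and>
    (\<forall>a m. lcoact M (lact M a m) = tensor_map2 (*) (lact M) (comult H a) (lcoact M m)) \<and>
    (\<forall>a m. lcoact M (ract M m a) = tensor_map2 (*) (ract M) (lcoact M m) (comult H a)) \<and>
    (\<forall>a m. rcoact M (lact M a m) = tensor_map2 (lact M) (*) (comult H a) (rcoact M m)) \<and>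
    (\<forall>a m. rcoact M (ract M m a) = tensor_map2 (ract M) (*) (rcoact M m) (comult H a))"

definition left_inv :: "('a::complex_algebra_1, 'm::complex_vector) bimod_data \<Rightarrow> 'm set"
  where "left_inv M = {m. lcoact M m = 1 \<otimes>\<^sub>\<complex> m}"

definition right_inv :: "('a::complex_algebra_1, 'm::complex_vector) bimod_data \<Rightarrow> 'm set"
  where "right_inv M = {m. rcoact M m = m \<otimes>\<^sub>\<complex> 1}"

definition finite_bimodule :: "('a::complex_algebra_1, 'm::complex_vector) bimod_data \<Rightarrow> bool"
  where "finite_bimodule M \<longleftrightarrow> (\<exists>B. finite B \<and> complex_vector.span B = left_inv M)"

text \<open>The multiplication maps between the (left or right) invariants tensored with the algebra and
  the bimodule are isomorphisms.\<close>

definition multiplication_isos :: "('a::complex_algebra_1, 'm::complex_vector) bimod_data \<Rightarrow> bool"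
  where "multiplication_isos M \<longleftrightarrow>
    bij_betw (tensor_lift (ract M)) (tensor_of_subspaces (left_inv M) UNIV) UNIV \<and>
    bij_betw (tensor_lift (lact M)) (tensor_of_subspaces UNIV (left_inv M)) UNIV \<and>
    bij_betw (tensor_lift (ract M)) (tensor_of_subspaces (right_inv M) UNIV) UNIV \<and>
    bij_betw (tensor_lift (lact M)) (tensor_of_subspaces UNIV (right_inv M)) UNIV"


section \<open>Tensor products over the algebra\<close>

text \<open>For a right action \<open>r\<close> and a left action \<open>l\<close> of the algebra, the balanced tensor product
  is the quotient of the tensor product over the complex numbers by the subspace
  \<open>balancing r l\<close>. Its elements are the cosets of that subspace, and addition of cosets is
  the elementwise sum of sets from the library theory on set algebras.\<close>

definition balancing ::
    "('m::complex_vector \<Rightarrow> 'a \<Rightarrow> 'm) \<Rightarrow> ('a \<Rightarrow> 'n::complex_vector \<Rightarrow> 'n) \<Rightarrow> ('m, 'n) tensor set"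
  where "balancing r l =
    complex_vector.span {r m a \<otimes>\<^sub>\<complex> n - m \<otimes>\<^sub>\<complex> l a n | m a n. True}"

abbreviation self_balancing ::
    "('a::complex_algebra_1, 'm::complex_vector) bimod_data \<Rightarrow> ('m, 'm) tensor set"
  where "self_balancing M \<equiv> balancing (ract M) (lact M)"

definition tensorA_carrier ::
    "('a::complex_algebra_1, 'm::complex_vector) bimod_data \<Rightarrow> ('m, 'm) tensor set set"
  where "tensorA_carrier M = range (\<lambda>x. x +o self_balancing M)"

definition tensorA ::
    "('a::complex_algebra_1, 'm::complex_vector) bimod_data \<Rightarrow> 'm \<Rightarrow> 'm \<Rightarrow> ('m, 'm) tensor set"
  where "tensorA M m n = (m \<otimes>\<^sub>\<complex> n) +o self_balancing M"

text \<open>The map on cosets induced by a linear map \<open>F\<close>, where \<open>W'\<close> is the subspace divided out in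
  the target: \<open>x + W\<close> goes to \<open>F x + W'\<close> whenever \<open>F\<close> maps \<open>W\<close> into \<open>W'\<close>.\<close>

definition coset_map :: "'w::complex_vector set \<Rightarrow> ('v::complex_vector \<Rightarrow> 'w) \<Rightarrow> 'v set \<Rightarrow> 'w set"
  where "coset_map W' F X = F ` X + W'"

definition tensorA_lact ::
    "('a::complex_algebra_1, 'm::complex_vector) bimod_data
      \<Rightarrow> 'a \<Rightarrow> ('m, 'm) tensor set \<Rightarrow> ('m, 'm) tensor set"
  where "tensorA_lact M a = coset_map (self_balancing M) (tensor_map (lact M a) id)"

definition tensorA_ract ::
    "('a::complex_algebra_1, 'm::complex_vector) bimod_data
      \<Rightarrow> ('m, 'm) tensor set \<Rightarrow> 'a \<Rightarrow> ('m, 'm) tensor set"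
  where "tensorA_ract M X a = coset_map (self_balancing M) (tensor_map id (\<lambda>m. ract M m a)) X"

text \<open>The left coaction
  \<open>m \<otimes>\<^sub>A n \<mapsto> m\<^sub>(\<^sub>-\<^sub>1\<^sub>) n\<^sub>(\<^sub>-\<^sub>1\<^sub>) \<otimes> m\<^sub>(\<^sub>0\<^sub>) \<otimes>\<^sub>A n\<^sub>(\<^sub>0\<^sub>)\<close>
  on the balanced tensor square of \<open>M\<close>. Its target is bracketed as the balanced tensor product of
  the right module \<open>A \<otimes> M\<close>, with the algebra \<open>A\<close> acting on the second factor, and the left
  module \<open>M\<close>.\<close>

definition amm_balancing ::
    "('a::complex_algebra_1, 'm::complex_vector) bimod_data \<Rightarrow> (('a, 'm) tensor, 'm) tensor set"
  where "amm_balancing M = balancing (\<lambda>x a. tensor_map id (\<lambda>m. ract M m a) x) (lact M)"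

definition tensorA_lcoact ::
    "('a::complex_algebra_1, 'm::complex_vector) bimod_data
      \<Rightarrow> ('m, 'm) tensor set \<Rightarrow> (('a, 'm) tensor, 'm) tensor set"
  where "tensorA_lcoact M = coset_map (amm_balancing M)
    (tensor_lift (\<lambda>m n.
      tensor_lift (\<lambda>a m0. tensor_lift (\<lambda>b n0. ((a * b) \<otimes>\<^sub>\<complex> m0) \<otimes>\<^sub>\<complex> n0) (lcoact M n)) (lcoact M m)))"

text \<open>The map \<open>id \<otimes> f\<close> from the target of \<open>tensorA_lcoact\<close> to \<open>A \<otimes> \<complex> = A\<close> for a linear functional
  \<open>f\<close> on the balanced tensor square. The image of a coset under the inner map is a singleton.\<close>

definition id_tensor_functional ::
    "('a::complex_algebra_1, 'm::complex_vector) bimod_data \<Rightarrow> (('m, 'm) tensor set \<Rightarrow> complex)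
      \<Rightarrow> (('a, 'm) tensor, 'm) tensor set \<Rightarrow> 'a"
  where "id_tensor_functional M f X =
    the_elem (tensor_lift (\<lambda>x n. tensor_lift (\<lambda>a m. f (tensorA M m n) *\<^sub>C a) x) ` X)"


section \<open>Braiding and pseudo-Riemannian metrics\<close>

text \<open>These conditions determine \<open>\<sigma>\<close> on \<open>tensorA_carrier M\<close> as soon as the multiplication maps
  are isomorphisms. Linearity over the complex numbers is part of linearity over the algebra.\<close>

definition is_braiding ::
    "('a::complex_algebra_1, 'm::complex_vector) bimod_data
      \<Rightarrow> (('m, 'm) tensor set \<Rightarrow> ('m, 'm) tensor set) \<Rightarrow> bool"
  where "is_braiding M \<sigma> \<longleftrightarrow>
    \<sigma> \<in> tensorA_carrier M \<rightarrow> tensorA_carrier M \<and>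
    (\<forall>X\<in>tensorA_carrier M. \<forall>Y\<in>tensorA_carrier M. \<sigma> (X + Y) = \<sigma> X + \<sigma> Y) \<and>
    (\<forall>X\<in>tensorA_carrier M. \<forall>a. \<sigma> (tensorA_lact M a X) = tensorA_lact M a (\<sigma> X)) \<and>
    (\<forall>X\<in>tensorA_carrier M. \<forall>a. \<sigma> (tensorA_ract M X a) = tensorA_ract M (\<sigma> X) a) \<and>
    (\<forall>\<omega>\<in>left_inv M. \<forall>\<eta>\<in>right_inv M. \<sigma> (tensorA M \<omega> \<eta>) = tensorA M \<eta> \<omega>)"

definition pseudo_riemannian_metric ::
    "('a::complex_algebra_1, 'm::complex_vector) bimod_data
      \<Rightarrow> (('m, 'm) tensor set \<Rightarrow> ('m, 'm) tensor set) \<Rightarrow> (('m, 'm) tensor set \<Rightarrow> 'a) \<Rightarrow> bool"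
  where "pseudo_riemannian_metric M \<sigma> g \<longleftrightarrow>
    (\<forall>X\<in>tensorA_carrier M. \<forall>Y\<in>tensorA_carrier M. g (X + Y) = g X + g Y) \<and>
    (\<forall>X\<in>tensorA_carrier M. \<forall>a. g (tensorA_ract M X a) = g X * a) \<and>
    (\<forall>X\<in>tensorA_carrier M. g (\<sigma> X) = g X) \<and>
    (\<forall>\<rho>. (\<forall>\<nu>. g (tensorA M \<rho> \<nu>) = 0) \<longrightarrow> \<rho> = 0)"

definition left_invariant ::
    "'a::complex_algebra_1 hopf_data \<Rightarrow> ('a, 'm::complex_vector) bimod_data
      \<Rightarrow> (('m, 'm) tensor set \<Rightarrow> 'a) \<Rightarrow> bool"
  where "left_invariant H M g \<longleftrightarrow>
    (\<forall>\<rho> \<nu>. id_tensor_functional M (\<lambda>X. counit H (g X)) (tensorA_lcoact M (tensorA M \<rho> \<nu>))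
      = g (tensorA M \<rho> \<nu>))"


section \<open>Duals, and the map and the matrix of a metric\<close>

text \<open>The right \<open>A\<close>-module of right \<open>A\<close>-linear maps from \<open>M\<close> to \<open>A\<close>.\<close>

definition right_dual :: "('a::complex_algebra_1, 'm::complex_vector) bimod_data \<Rightarrow> ('m \<Rightarrow> 'a) set"
  where "right_dual M =
    {\<phi>. (\<forall>x y. \<phi> (x + y) = \<phi> x + \<phi> y) \<and> (\<forall>x a. \<phi> (ract M x a) = \<phi> x * a)}"

definition dual_ract ::
    "('a::complex_algebra_1, 'm::complex_vector) bimod_data \<Rightarrow> ('m \<Rightarrow> 'a) \<Rightarrow> 'a \<Rightarrow> ('m \<Rightarrow> 'a)"
  where "dual_ract M \<phi> a = (\<lambda>e. \<phi> (lact M a e))"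

text \<open>Linear functionals on a subspace \<open>U\<close>, as functions that are undefined outside \<open>U\<close>.\<close>

definition subspace_dual :: "'m::complex_vector set \<Rightarrow> ('m \<Rightarrow> complex) set"
  where "subspace_dual U =
    {\<phi> \<in> extensional U. (\<forall>x\<in>U. \<forall>y\<in>U. \<phi> (x + y) = \<phi> x + \<phi> y) \<and>
      (\<forall>c. \<forall>x\<in>U. \<phi> (c *\<^sub>C x) = c * \<phi> x)}"

definition metric_map ::
    "('a::complex_algebra_1, 'm::complex_vector) bimod_data \<Rightarrow> (('m, 'm) tensor set \<Rightarrow> 'a)
      \<Rightarrow> 'm \<Rightarrow> ('m \<Rightarrow> 'a)"
  where "metric_map M g e = (\<lambda>f. g (tensorA M e f))"

text \<open>\<open>metric_map\<close> on invariant elements, viewed as a complex functional on the invariant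
  elements by restriction.\<close>

definition metric_map_inv ::
    "('a::complex_algebra_1, 'm::complex_vector) bimod_data \<Rightarrow> (('m, 'm) tensor set \<Rightarrow> 'a)
      \<Rightarrow> 'm \<Rightarrow> ('m \<Rightarrow> complex)"
  where "metric_map_inv M g e = (\<lambda>f\<in>left_inv M. scalar_of (metric_map M g e f))"


definition metric_matrix ::
    "('a::complex_algebra_1, 'm::complex_vector) bimod_data \<Rightarrow> (('m, 'm) tensor set \<Rightarrow> 'a)
      \<Rightarrow> nat \<Rightarrow> (nat \<Rightarrow> 'm) \<Rightarrow> 'a mat"
  where "metric_matrix M g n \<omega> = mat n n (\<lambda>(i, j). g (tensorA M (\<omega> i) (\<omega> j)))"


section \<open>The universal property of the tensor product\<close>

lemma tensor_add_left: "(m + m') \<otimes>\<^sub>\<complex> n = m \<otimes>\<^sub>\<complex> n + m' \<otimes>\<^sub>\<complex> n"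
  by transfer (unfold tensor_rel_def bilinearity_relators_def diff_diff_eq[symmetric],
      rule free.span_base, blast)

lemma tensor_add_right: "m \<otimes>\<^sub>\<complex> (n + n') = m \<otimes>\<^sub>\<complex> n + m \<otimes>\<^sub>\<complex> n'"
  by transfer (unfold tensor_rel_def bilinearity_relators_def diff_diff_eq[symmetric],
      rule free.span_base, blast)

lemma tensor_scale_left: "(c *\<^sub>C m) \<otimes>\<^sub>\<complex> n = c *\<^sub>C (m \<otimes>\<^sub>\<complex> n)"
  by transfer (unfold tensor_rel_def bilinearity_relators_def, rule free.span_base, blast)

lemma tensor_scale_right: "m \<otimes>\<^sub>\<complex> (c *\<^sub>C n) = c *\<^sub>C (m \<otimes>\<^sub>\<complex> n)"
  by transfer (unfold tensor_rel_def bilinearity_relators_def, rule free.span_base, blast)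

lemma clinear_iff:
  "clinear f \<longleftrightarrow> (\<forall>x y. f (x + y) = f x + f y) \<and> (\<forall>c x. f (c *\<^sub>C x) = c *\<^sub>C f x)"
  by (simp add: Vector_Spaces.linear_iff complex_vector.vector_space_axioms)

lemma cbilinear_tensor: "cbilinear (\<otimes>\<^sub>\<complex>)"
  by (simp add: cbilinear_def clinear_iff tensor_add_left tensor_add_right tensor_scale_left
      tensor_scale_right)

definition free_eval :: "('a \<Rightarrow> 'b \<Rightarrow> 'c::complex_vector) \<Rightarrow> ('a \<times> 'b \<Rightarrow>\<^sub>0 complex) \<Rightarrow> 'c"
  where "free_eval f p = (\<Sum>(a, b)\<in>Poly_Mapping.keys p. Poly_Mapping.lookup p (a, b) *\<^sub>C f a b)"

lemma free_eval_superset: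
  assumes "finite S" "Poly_Mapping.keys p \<subseteq> S"
  shows "free_eval f p = (\<Sum>(a, b)\<in>S. Poly_Mapping.lookup p (a, b) *\<^sub>C f a b)"
  unfolding free_eval_def
  by (rule sum.mono_neutral_left) (use assms in \<open>auto simp: in_keys_iff\<close>)

lemma free_eval_add: "free_eval f (p + q) = free_eval f p + free_eval f q"
proof -
  let ?S = "Poly_Mapping.keys p \<union> Poly_Mapping.keys q"
  have "Poly_Mapping.keys (p + q) \<subseteq> ?S" by (rule Poly_Mapping.keys_add)
  then show ?thesis
    by (simp add: free_eval_superset[of ?S] lookup_add scaleC_add_left sum.distrib case_prod_beta)
qed

lemma free_eval_scale: "free_eval f (free_scale c p) = c *\<^sub>C free_eval f p"
proof -
  have "Poly_Mapping.keys (free_scale c p) \<subseteq> Poly_Mapping.keys p"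
    by (auto simp: in_keys_iff lookup_free_scale)
  then have "free_eval f (free_scale c p)
      = (\<Sum>(a, b)\<in>Poly_Mapping.keys p. Poly_Mapping.lookup (free_scale c p) (a, b) *\<^sub>C f a b)"
    by (rule free_eval_superset[OF finite_keys])
  also have "\<dots> = c *\<^sub>C free_eval f p"
    by (simp add: free_eval_def lookup_free_scale
        complex_vector.scale_sum_right case_prod_beta)
  finally show ?thesis .
qed

lemma free_eval_diff: "free_eval f (p - q) = free_eval f p - free_eval f q"
  using free_eval_add[of f "p - q" q] by simp

lemma free_eval_gen [simp]: "free_eval f (gen a b) = f a b"
  by (simp add: free_eval_def scaleC_one)

lemma free_eval_relators:
  assumes f: "cbilinear f" and p: "p \<in> free.span bilinearity_relators"
  shows "free_eval f p = 0"
  using p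
proof (induction rule: free.span_induct_alt)
  case base
  show ?case by (simp add: free_eval_def)
next
  case (step c x y)
  have "free_eval f x = 0"
    using step(1) f
    by (auto simp: bilinearity_relators_def free_eval_diff free_eval_scale cbilinear_def
        clinear_iff)
  then show ?case using step by (simp add: free_eval_add free_eval_scale)
qed

lemma rep_tensor_rel: "tensor_rel (rep_tensor (abs_tensor p)) p"
  by (rule rep_abs_rsp_left[OF Quotient3_tensor])
    (simp add: tensor_rel_def free.span_zero)

lemma tensor_lift_abs:
  assumes "cbilinear f"
  shows "tensor_lift f (abs_tensor p) = free_eval f p"
  using free_eval_relators[OF assms rep_tensor_rel[unfolded tensor_rel_def], of p]
  by (simp add: free_eval_diff tensor_lift_def Let_def flip: free_eval_def)

lemma tensor_lift_tensor:
  assumes "cbilinear f"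
  shows "tensor_lift f (a \<otimes>\<^sub>\<complex> b) = f a b"
  by (simp add: tensor.abs_eq tensor_lift_abs[OF assms])

lemma clinear_tensor_lift:
  assumes "cbilinear f"
  shows "clinear (tensor_lift f)"
  unfolding clinear_iff
proof (intro conjI allI)
  fix x y :: "('a, 'b) tensor" and c :: complex
  obtain p q where x: "x = abs_tensor p" and y: "y = abs_tensor q"
    using Quotient3_abs_rep[OF Quotient3_tensor, symmetric] by blast
  show "tensor_lift f (x + y) = tensor_lift f x + tensor_lift f y"
    by (simp add: x y plus_tensor.abs_eq tensor_lift_abs[OF assms] free_eval_add)
  show "tensor_lift f (c *\<^sub>C x) = c *\<^sub>C tensor_lift f x"
    by (simp add: x scaleC_tensor.abs_eq tensor_lift_abs[OF assms] free_eval_scale)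
qed

lemma tensor_span: "complex_vector.span (range (\<lambda>(a, b). a \<otimes>\<^sub>\<complex> b)) = UNIV"
proof -
  let ?S = "complex_vector.span (range (\<lambda>(a, b). a \<otimes>\<^sub>\<complex> b)) :: ('a, 'b) tensor set"
  have "abs_tensor p \<in> ?S" if "Poly_Mapping.keys p = K" "finite K" for p K
    using that(2,1)
  proof (induction K arbitrary: p rule: finite_induct)
    case empty
    then have "p = 0" by simp
    then show ?case
      using complex_vector.span_zero by (simp add: zero_tensor.abs_eq[symmetric])
  next
    case (insert k K)
    obtain a b where k: "k = (a, b)" by (cases k)
    let ?c = "Poly_Mapping.lookup p k"
    let ?q = "p - free_scale ?c (gen a b)"
    have "Poly_Mapping.keys ?q = K"
      using insert.hyps(2) insert.prems
      by (auto simp: set_eq_iff in_keys_iff lookup_minus lookup_free_scale lookup_single when_def k)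
    then have "abs_tensor ?q \<in> ?S" by (rule insert.IH)
    moreover have "?c *\<^sub>C (a \<otimes>\<^sub>\<complex> b) \<in> ?S"
      by (intro complex_vector.span_scale complex_vector.span_base) auto
    ultimately have "abs_tensor ?q + ?c *\<^sub>C (a \<otimes>\<^sub>\<complex> b) \<in> ?S"
      by (rule complex_vector.span_add)
    then show ?case
      by (simp add: tensor.abs_eq scaleC_tensor.abs_eq plus_tensor.abs_eq)
  qed
  then have "abs_tensor (rep_tensor x) \<in> ?S" for x :: "('a, 'b) tensor"
    using finite_keys by blast
  then show ?thesis
    by (auto simp: Quotient3_abs_rep[OF Quotient3_tensor])
qed

end

theory Submission
  imports Defs "Jordan_Normal_Form.Determinant"
begin

text \<open>Left-invariance makes the values of \<open>g\<close> on pairs of left-invariant elements scalars, so the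
  matrix \<open>(g\<^sub>i\<^sub>j)\<close> comes from a complex matrix. Since \<open>E = \<^sub>0E A\<close> and \<open>g\<close> is right
  \<open>A\<close>-linear, an element of \<open>E\<close> orthogonal on the left to \<open>\<^sub>0E\<close> is zero. Hence the complex matrix
  has trivial left kernel and is invertible. Writing \<open>f = \<Sum>j. \<omega>\<^sub>j a\<^sub>j\<close>, the condition
  \<open>g(\<omega>\<^sub>i \<otimes> f) = 0\<close> for all \<open>i\<close> reads \<open>\<Sum>j. g\<^sub>i\<^sub>j a\<^sub>j = 0\<close>, so multiplying by the inverse matrix
  gives \<open>f = 0\<close>.\<close>

section \<open>Linear maps on tensor products\<close>

lemma clinear_add: "clinear f \<Longrightarrow> f (x + y) = f x + f y"
  and clinear_scale: "clinear f \<Longrightarrow> f (c *\<^sub>C x) = c *\<^sub>C f x"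
  by (simp_all add: clinear_iff)

lemma clinear_zero: "clinear f \<Longrightarrow> f 0 = 0"
  by (metis add_cancel_right_left clinear_iff)

lemma clinear_diff: "clinear f \<Longrightarrow> f (x - y) = f x - f y"
  by (metis add_diff_cancel_right' clinear_iff diff_add_cancel)

lemma clinear_compose: "clinear f \<Longrightarrow> clinear h \<Longrightarrow> clinear (\<lambda>x. f (h x))"
  by (simp add: clinear_iff)

lemma clinear_id: "clinear id"
  by (simp add: clinear_iff)

lemma cbilinearI:
  assumes "\<And>y. clinear (\<lambda>x. f x y)" "\<And>x. clinear (f x)"
  shows "cbilinear f"
  using assms by (simp add: cbilinear_def)

lemma clinear_zero_on_span:
  assumes "clinear F" "\<And>x. x \<in> S \<Longrightarrow> F x = 0" "x \<in> complex_vector.span S"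
  shows "F x = 0"
  using assms(3)
  by (induction rule: complex_vector.span_induct_alt)
    (simp_all add: assms(2) clinear_zero[OF assms(1)] clinear_add[OF assms(1)]
      clinear_scale[OF assms(1)])

text \<open>Pure tensors span the tensor product, and the difference of the two maps vanishes on
  them.\<close>

lemma clinear_tensor_eqI:
  assumes "clinear F" "clinear G" "\<And>a b. F (a \<otimes>\<^sub>\<complex> b) = G (a \<otimes>\<^sub>\<complex> b)"
  shows "F x = G x"
proof -
  have "clinear (\<lambda>x. F x - G x)"
    using assms(1,2) by (simp add: clinear_iff complex_vector.scale_right_diff_distrib)
  then have "F x - G x = 0"
  proof (rule clinear_zero_on_span)
    show "F y - G y = 0" if "y \<in> range (\<lambda>(a, b). a \<otimes>\<^sub>\<complex> b)" for y
      using that assms(3) by auto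
    show "x \<in> complex_vector.span (range (\<lambda>(a, b). a \<otimes>\<^sub>\<complex> b))"
      by (simp add: tensor_span)
  qed
  then show ?thesis by simp
qed

text \<open>The lift at \<open>x\<close> is a finite sum over a representative of \<open>x\<close>
  chosen independently of \<open>z\<close>, so linearity in \<open>z\<close> holds term by
  term.\<close>

lemma clinear_tensor_lift_parameter:
  assumes "\<And>a b. clinear (\<lambda>z. f z a b)"
  shows "clinear (\<lambda>z. tensor_lift (f z) x)"
  using assms
  by (simp add: clinear_iff tensor_lift_def Let_def case_prod_beta sum.distrib
      scaleC_add_right complex_vector.scale_sum_right scaleC_scaleC mult.commute)

text \<open>Nested lifts of this shape define both \<open>tensor_map2\<close> and the coaction on
  the tensor square. Linearity in \<open>x\<close> comes from the outer lift, linearity in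
  \<open>y\<close> from treating \<open>y\<close> as a parameter of it.\<close>

lemma cbilinear_tensor_lift2:
  assumes "\<And>m b n. clinear (\<lambda>a. h a m b n)" "\<And>a b n. clinear (\<lambda>m. h a m b n)"
    and "\<And>a m n. clinear (\<lambda>b. h a m b n)" "\<And>a m b. clinear (\<lambda>n. h a m b n)"
  shows "cbilinear (\<lambda>x y. tensor_lift (\<lambda>a m. tensor_lift (\<lambda>b n. h a m b n) y) x)"
  by (intro cbilinearI clinear_tensor_lift clinear_tensor_lift_parameter assms)

lemma tensor_lift2_tensor:
  assumes "\<And>m b n. clinear (\<lambda>a. h a m b n)" "\<And>a b n. clinear (\<lambda>m. h a m b n)"
    and "\<And>a m n. clinear (\<lambda>b. h a m b n)" "\<And>a m b. clinear (\<lambda>n. h a m b n)"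
  shows "tensor_lift (\<lambda>a m. tensor_lift (\<lambda>b n. h a m b n) (b' \<otimes>\<^sub>\<complex> n')) (a' \<otimes>\<^sub>\<complex> m') = h a' m' b' n'"
proof -
  have "cbilinear (\<lambda>a m. tensor_lift (\<lambda>b n. h a m b n) (b' \<otimes>\<^sub>\<complex> n'))"
    by (intro cbilinearI clinear_tensor_lift_parameter assms)
  moreover have "cbilinear (h a' m')"
    by (intro cbilinearI assms)
  ultimately show ?thesis
    by (simp add: tensor_lift_tensor)
qed

lemma clinear_tensor_left: "clinear (\<lambda>m. m \<otimes>\<^sub>\<complex> n)"
  and clinear_tensor_right: "clinear (\<lambda>n. m \<otimes>\<^sub>\<complex> n)"
  by (simp_all add: clinear_iff tensor_add_left tensor_add_right tensor_scale_left
      tensor_scale_right)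

lemma
  assumes "clinear f" "clinear h"
  shows clinear_tensor_map: "clinear (tensor_map f h)"
    and tensor_map_tensor: "tensor_map f h (a \<otimes>\<^sub>\<complex> b) = f a \<otimes>\<^sub>\<complex> h b"
proof -
  have "cbilinear (\<lambda>a b. f a \<otimes>\<^sub>\<complex> h b)"
    by (intro cbilinearI clinear_compose[OF clinear_tensor_left assms(1)]
        clinear_compose[OF clinear_tensor_right assms(2)])
  then show "clinear (tensor_map f h)" "tensor_map f h (a \<otimes>\<^sub>\<complex> b) = f a \<otimes>\<^sub>\<complex> h b"
    by (simp_all add: tensor_map_def clinear_tensor_lift tensor_lift_tensor)
qed

lemma
  assumes "cbilinear f" "cbilinear h"
  shows cbilinear_tensor_map2: "cbilinear (tensor_map2 f h)"
    and tensor_map2_tensor: "tensor_map2 f h (a \<otimes>\<^sub>\<complex> b) (c \<otimes>\<^sub>\<complex> d) = f a c \<otimes>\<^sub>\<complex> h b d"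
proof -
  have *: "clinear (\<lambda>a. f a c \<otimes>\<^sub>\<complex> h b d)" "clinear (\<lambda>b. f a c \<otimes>\<^sub>\<complex> h b d)"
    "clinear (\<lambda>c. f a c \<otimes>\<^sub>\<complex> h b d)" "clinear (\<lambda>d. f a c \<otimes>\<^sub>\<complex> h b d)" for a b c d
    using assms unfolding cbilinear_def
    by (auto intro: clinear_compose[OF clinear_tensor_left] clinear_compose[OF clinear_tensor_right])
  show "cbilinear (tensor_map2 f h)"
    unfolding tensor_map2_def by (intro cbilinear_tensor_lift2 *)
  show "tensor_map2 f h (a \<otimes>\<^sub>\<complex> b) (c \<otimes>\<^sub>\<complex> d) = f a c \<otimes>\<^sub>\<complex> h b d"
    unfolding tensor_map2_def by (rule tensor_lift2_tensor) (rule *)+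
qed

lemma cbilinear_mult: "cbilinear ((*) :: 'a::complex_algebra_1 \<Rightarrow> _)"
  by (simp add: cbilinear_def clinear_iff algebra_simps mult_scaleC_left mult_scaleC_right)


section \<open>The balanced tensor product\<close>

text \<open>Cosets are added elementwise, so a sum of two cosets contains the subspace twice; this
  collapses the two copies.\<close>

lemma span_plus_span:
  "complex_vector.span S + complex_vector.span S = complex_vector.span (S :: 'v::complex_vector set)"
proof -
  have "x \<in> complex_vector.span S + complex_vector.span S" if "x \<in> complex_vector.span S" for x
    using set_plus_intro[OF that complex_vector.span_zero[of S]] by simp
  then show ?thesis
    by (auto simp: complex_vector.span_add elim: set_plus_elim)
qed

text \<open>\<open>F\<close> carries the span of \<open>S\<close> into the span of
  \<open>S'\<close>, so adding the latter absorbs the image of the former and leaves a single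
  coset.\<close>

lemma coset_map_coset:
  assumes F: "clinear F" and S: "\<And>x. x \<in> S \<Longrightarrow> F x \<in> complex_vector.span S'"
  shows "coset_map (complex_vector.span S') F (x +o complex_vector.span S)
    = F x +o complex_vector.span S'"
proof -
  have "F w \<in> complex_vector.span S'" if "w \<in> complex_vector.span S" for w
    using that
    by (induction rule: complex_vector.span_induct_alt)
      (simp_all add: clinear_zero[OF F] clinear_add[OF F] clinear_scale[OF F]
        complex_vector.span_zero complex_vector.span_add complex_vector.span_scale S)
  then have sub: "F ` complex_vector.span S \<subseteq> complex_vector.span S'" by blast
  have "F ` complex_vector.span S + complex_vector.span S' = complex_vector.span S'" (is "?L = _")
  proof
    show "?L \<subseteq> complex_vector.span S'"
      using sub by (auto simp: set_plus_def complex_vector.span_add)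
    show "complex_vector.span S' \<subseteq> ?L"
    proof
      fix y assume "y \<in> complex_vector.span S'"
      with set_plus_intro[OF imageI[OF complex_vector.span_zero] this, of F S]
      show "y \<in> ?L" by (simp add: clinear_zero[OF F])
    qed
  qed
  moreover have "F ` (x +o complex_vector.span S) = F x +o F ` complex_vector.span S"
  proof -
    have translate: "a +o A = (\<lambda>b. a + b) ` A" for a :: "'z::plus" and A
      by (auto simp: elt_set_plus_def)
    show ?thesis by (simp add: translate image_image clinear_add[OF F])
  qed
  ultimately show ?thesis
    by (simp add: coset_map_def set_plus_rearrange3)
qed

lemma coset_eqI:
  assumes "x - y \<in> complex_vector.span S"
  shows "x +o complex_vector.span S = y +o complex_vector.span S"
proof -
  have "x + b = y + ((x - y) + b)" "y + b = x + (- (x - y) + b)" for b by simp_all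
  then show ?thesis
    using assms complex_vector.span_add complex_vector.span_neg
    unfolding elt_set_plus_def by blast
qed

lemma tensorA_in_carrier [simp]: "tensorA M x y \<in> tensorA_carrier M"
  by (simp add: tensorA_def tensorA_carrier_def)

lemma
  shows tensorA_add_left: "tensorA M (x + x') y = tensorA M x y + tensorA M x' y"
    and tensorA_add_right: "tensorA M x (y + y') = tensorA M x y + tensorA M x y'"
  by (simp_all add: tensorA_def tensor_add_left tensor_add_right set_plus_rearrange balancing_def
      span_plus_span)

lemma tensorA_balanced: "tensorA M (ract M x a) y = tensorA M x (lact M a y)"
  unfolding tensorA_def balancing_def
  by (intro coset_eqI complex_vector.span_base) blast

lemma bimodule_linear:
  assumes "bimodule M"
  shows "clinear (lact M a)" "clinear (\<lambda>a. lact M a m)" "clinear (ract M m)"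
    "clinear (\<lambda>m. ract M m a)" "cbilinear (lact M)" "cbilinear (ract M)"
  using assms by (simp_all add: bimodule_def cbilinear_def)

text \<open>Complex scalars act as the algebra elements \<open>c *\<^sub>C 1\<close>; this is how
  complex linearity will follow from linearity over the algebra.\<close>

lemma bimodule_scale:
  assumes "bimodule M"
  shows "ract M m (c *\<^sub>C 1) = c *\<^sub>C m" "lact M (c *\<^sub>C 1) m = c *\<^sub>C m"
  using clinear_scale[OF bimodule_linear(3)[OF assms, of m], of c 1]
    clinear_scale[OF bimodule_linear(2)[OF assms, of m], of c 1] assms
  by (simp_all add: bimodule_def)

text \<open>The action on the second factor preserves the balancing relators because the left and
  right actions commute, so it can be computed on representatives.\<close>

lemma tensorA_ract_tensorA:
  assumes "bimodule M"
  shows "tensorA_ract M (tensorA M x y) a = tensorA M x (ract M y a)"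
proof -
  note lin = bimodule_linear[OF assms] clinear_id
  note simps = clinear_diff[OF clinear_tensor_map] tensor_map_tensor lin
  have "tensor_map id (\<lambda>m. ract M m a) w \<in> complex_vector.span
      {ract M m c \<otimes>\<^sub>\<complex> k - m \<otimes>\<^sub>\<complex> lact M c k | m c k. True}"
    if w_in: "w \<in> {ract M m c \<otimes>\<^sub>\<complex> k - m \<otimes>\<^sub>\<complex> lact M c k | m c k. True}" for w
  proof -
    obtain m c k where w: "w = ract M m c \<otimes>\<^sub>\<complex> k - m \<otimes>\<^sub>\<complex> lact M c k"
      using w_in by blast
    have "tensor_map id (\<lambda>m. ract M m a) w
        = ract M m c \<otimes>\<^sub>\<complex> ract M k a - m \<otimes>\<^sub>\<complex> lact M c (ract M k a)"
      using assms by (simp add: w simps bimodule_def)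
    then show ?thesis
      by (intro complex_vector.span_base) blast
  qed
  then show ?thesis
    unfolding tensorA_ract_def tensorA_def balancing_def
    by (subst coset_map_coset) (simp_all add: simps clinear_tensor_map)
qed


section \<open>Left-invariant pairings take scalar values on invariant elements\<close>

locale right_linear_pairing =
  fixes M :: "('a::complex_algebra_1, 'm::complex_vector) bimod_data"
    and g :: "('m, 'm) tensor set \<Rightarrow> 'a"
  assumes bimodule: "bimodule M"
    and g_add: "\<And>X Y. X \<in> tensorA_carrier M \<Longrightarrow> Y \<in> tensorA_carrier M \<Longrightarrow> g (X + Y) = g X + g Y"
    and g_ract: "\<And>X a. X \<in> tensorA_carrier M \<Longrightarrow> g (tensorA_ract M X a) = g X * a"
begin

definition pairing :: "'m \<Rightarrow> 'm \<Rightarrow> 'a"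
  where "pairing x y = g (tensorA M x y)"

lemma pairing_add_left: "pairing (x + x') y = pairing x y + pairing x' y"
  and pairing_add_right: "pairing x (y + y') = pairing x y + pairing x y'"
  by (simp_all add: pairing_def tensorA_add_left tensorA_add_right g_add)

lemma pairing_ract: "pairing x (ract M y a) = pairing x y * a"
  using g_ract[of "tensorA M x y" a] by (simp add: pairing_def tensorA_ract_tensorA bimodule)

lemma pairing_balanced: "pairing (ract M x a) y = pairing x (lact M a y)"
  by (simp add: pairing_def tensorA_balanced)

lemma pairing_scale_right: "pairing x (c *\<^sub>C y) = c *\<^sub>C pairing x y"
  using pairing_ract[of x y "c *\<^sub>C 1"] by (simp add: bimodule_scale bimodule mult_scaleC_right)

text \<open>\<open>g\<close> is linear over the algebra only on the right, so the scalar crosses the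
  tensor sign as \<open>c *\<^sub>C 1\<close> and is pulled out of the second argument.\<close>

lemma pairing_scale_left: "pairing (c *\<^sub>C x) y = c *\<^sub>C pairing x y"
  using pairing_balanced[of x "c *\<^sub>C 1" y] by (simp add: bimodule_scale bimodule pairing_scale_right)

lemma cbilinear_pairing: "cbilinear pairing"
  by (simp add: cbilinear_def clinear_iff pairing_add_left pairing_add_right pairing_scale_left
      pairing_scale_right)

lemma pairing_diff_left: "pairing (x - x') y = pairing x y - pairing x' y"
  using cbilinear_pairing clinear_diff[of "\<lambda>x. pairing x y"] by (simp add: cbilinear_def)

lemma pairing_sum_left: "pairing (\<Sum>i\<in>I. u i) y = (\<Sum>i\<in>I. pairing (u i) y)"
  and pairing_sum_right: "pairing x (\<Sum>i\<in>I. v i) = (\<Sum>i\<in>I. pairing x (v i))"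
  \<comment> \<open>The instances at 0 show that pairing with 0 gives 0. This settles the empty
    index set and also infinite ones, where sums are 0 by convention.\<close>
  using pairing_add_left[of 0 0 y] pairing_add_right[of x 0 0]
  by (induction I rule: infinite_finite_induct; simp add: pairing_add_left pairing_add_right)+

text \<open>For invariant \<open>x\<close> and \<open>y\<close> the coaction of their tensor product
  has algebra leg 1, so applying the counit of \<open>g\<close> to the other legs yields a multiple
  of 1; left-invariance says that this multiple is \<open>g\<close> itself.\<close>

lemma invariant_pairing_scalar:
  assumes counit: "clinear (counit H)"
    and lcoact_ract: "\<And>m a. lcoact M (ract M m a)
        = tensor_map2 (*) (ract M) (lcoact M m) (comult H a)"
    and lcoact_lact: "\<And>m a. lcoact M (lact M a m)
        = tensor_map2 (*) (lact M) (comult H a) (lcoact M m)"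
    and lcoact: "clinear (lcoact M)"
    and invariant: "left_invariant H M g"
    and x: "x \<in> left_inv M" and y: "y \<in> left_inv M"
  shows "pairing x y \<in> scalars"
proof -
  text \<open>\<open>F\<close> represents the coaction on \<open>M \<otimes>\<^sub>\<complex> M\<close> and \<open>G\<close> represents \<open>id \<otimes> \<epsilon>g\<close>. Both \<open>G \<circ> F\<close> and \<open>G\<close>
    vanish on the respective balancing subspaces, so the image whose \<^const>\<open>the_elem\<close> is taken in
    the definition of left-invariance is a singleton.\<close>
  define P where "P m n = counit H (pairing m n)" for m n
  define G where "G = tensor_lift (\<lambda>x n. tensor_lift (\<lambda>(a::'a) m. P m n *\<^sub>C a) x)"
  \<comment> \<open>\<open>J\<close> merges two coactions: the algebra legs are multiplied and the
    module legs are kept side by side.\<close>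
  define J where "J X Y = tensor_lift (\<lambda>a m0. tensor_lift
    (\<lambda>b n0. ((a * b) \<otimes>\<^sub>\<complex> m0) \<otimes>\<^sub>\<complex> n0) Y) X" for X Y :: "('a, 'm) tensor"
  define F where "F = tensor_lift (\<lambda>m n. J (lcoact M m) (lcoact M n))"
  have P_lin: "clinear (\<lambda>m. P m n)" "clinear (\<lambda>n. P m n)" for m n
    using cbilinear_pairing unfolding P_def cbilinear_def
    by (auto intro: clinear_compose[OF counit])
  have P_balanced: "P (ract M m c) n = P m (lact M c n)" for m c n
    by (simp add: P_def pairing_balanced)
  have P_scale: "cbilinear (\<lambda>a m. P m n *\<^sub>C (a::'a))" "clinear (\<lambda>n. P m n *\<^sub>C (a::'a))"
    for n m a
    using P_lin by (simp_all add: cbilinear_def clinear_iff complex_vector.scale_left_distrib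
        complex_vector.scale_right_distrib scaleC_complex_def mult.commute)
  have G_bil: "cbilinear (\<lambda>x n. tensor_lift (\<lambda>(a::'a) m. P m n *\<^sub>C a) x)"
    by (intro cbilinearI clinear_tensor_lift clinear_tensor_lift_parameter P_scale)
  have G_lin: "clinear G"
    unfolding G_def by (rule clinear_tensor_lift[OF G_bil])
  have G_tensor: "G (X \<otimes>\<^sub>\<complex> n) = tensor_lift (\<lambda>a m. P m n *\<^sub>C a) X" for X n
    unfolding G_def by (rule tensor_lift_tensor[OF G_bil])
  have G_tensor': "G ((a \<otimes>\<^sub>\<complex> m) \<otimes>\<^sub>\<complex> n) = P m n *\<^sub>C a" for a m n
    unfolding G_tensor by (rule tensor_lift_tensor[OF P_scale(1)])
  have J_lin: "clinear (\<lambda>a. ((a * b) \<otimes>\<^sub>\<complex> m0) \<otimes>\<^sub>\<complex> n0)" "clinear (\<lambda>m0. ((a * b) \<otimes>\<^sub>\<complex> m0) \<otimes>\<^sub>\<complex> n0)"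
    "clinear (\<lambda>b. ((a * b) \<otimes>\<^sub>\<complex> m0) \<otimes>\<^sub>\<complex> n0)" "clinear (\<lambda>n0. ((a * b) \<otimes>\<^sub>\<complex> m0) \<otimes>\<^sub>\<complex> n0)"
    for a b :: 'a and m0 n0 :: 'm
    by (simp_all add: clinear_iff tensor_add_left tensor_add_right tensor_scale_left
        tensor_scale_right algebra_simps mult_scaleC_left mult_scaleC_right)
  have J_bil: "cbilinear J"
    unfolding J_def by (intro cbilinear_tensor_lift2 J_lin)
  have J_tensor: "J (a \<otimes>\<^sub>\<complex> m) (b \<otimes>\<^sub>\<complex> n) = ((a * b) \<otimes>\<^sub>\<complex> m) \<otimes>\<^sub>\<complex> n" for a m b n
    unfolding J_def by (rule tensor_lift2_tensor) (rule J_lin)+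
  have F_bil: "cbilinear (\<lambda>m n. J (lcoact M m) (lcoact M n))"
    using J_bil lcoact by (simp add: cbilinear_def clinear_iff)
  have F_lin: "clinear F"
    unfolding F_def by (rule clinear_tensor_lift[OF F_bil])
  have F_tensor: "F (m \<otimes>\<^sub>\<complex> n) = J (lcoact M m) (lcoact M n)" for m n
    unfolding F_def by (rule tensor_lift_tensor[OF F_bil])
  \<comment> \<open>Fed with a coaction and a comultiplication, \<open>R\<close> and
    \<open>L\<close> compute the coactions of \<open>ract M m a\<close> and
    \<open>lact M a m\<close>.\<close>
  define R where "R = tensor_map2 ((*) :: 'a \<Rightarrow> 'a \<Rightarrow> 'a) (ract M)"
  define L where "L = tensor_map2 ((*) :: 'a \<Rightarrow> 'a \<Rightarrow> 'a) (lact M)"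
  note bil = cbilinear_mult bimodule_linear(5,6)[OF bimodule]
  have R_bil: "cbilinear R" and L_bil: "cbilinear L"
    unfolding R_def L_def by (intro cbilinear_tensor_map2 bil)+
  have R_lin: "clinear (\<lambda>X. R X Y)" "clinear (R X)" and L_lin: "clinear (\<lambda>Y. L Y Z)" "clinear (L Y)"
    and J_lin': "clinear (\<lambda>X. J X W)" "clinear (J V)" for X Y Z V W
    using R_bil L_bil J_bil by (simp_all add: cbilinear_def)
  have GJ_lin: "clinear (\<lambda>X. G (J X W))" "clinear (\<lambda>X. G (J V X))" for V W
    by (rule clinear_compose[OF G_lin], rule J_lin')+
  \<comment> \<open>The middle tensor plays the role of a comultiplication: \<open>b\<close> moves
    between the algebra legs by associativity, and \<open>c\<close> crosses the tensor sign because
    \<open>P\<close> is balanced.\<close>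
  have pure: "G (J (R (a \<otimes>\<^sub>\<complex> m) (b \<otimes>\<^sub>\<complex> c)) (d \<otimes>\<^sub>\<complex> n))
      = G (J (a \<otimes>\<^sub>\<complex> m) (L (b \<otimes>\<^sub>\<complex> c) (d \<otimes>\<^sub>\<complex> n)))" for a m b c d n
    by (simp only: R_def L_def tensor_map2_tensor bil J_tensor G_tensor' P_balanced mult.assoc)
  \<comment> \<open>Linearity in one slot at a time extends the identity to arbitrary tensors, first
    \<open>Z\<close>, then \<open>Y\<close>, then \<open>X\<close>.\<close>
  have pure_left_mid: "G (J (R (a \<otimes>\<^sub>\<complex> m) (b \<otimes>\<^sub>\<complex> c)) Z) = G (J (a \<otimes>\<^sub>\<complex> m) (L (b \<otimes>\<^sub>\<complex> c) Z))"
    for a m b c Z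
    using clinear_tensor_eqI[where F = "\<lambda>Z. G (J (R (a \<otimes>\<^sub>\<complex> m) (b \<otimes>\<^sub>\<complex> c)) Z)"
        and G = "\<lambda>Z. G (J (a \<otimes>\<^sub>\<complex> m) (L (b \<otimes>\<^sub>\<complex> c) Z))",
        OF GJ_lin(2) clinear_compose[OF GJ_lin(2) L_lin(2)] pure] .
  have pure_left: "G (J (R (a \<otimes>\<^sub>\<complex> m) Y) Z) = G (J (a \<otimes>\<^sub>\<complex> m) (L Y Z))" for a m Y Z
    using clinear_tensor_eqI[where F = "\<lambda>Y. G (J (R (a \<otimes>\<^sub>\<complex> m) Y) Z)"
        and G = "\<lambda>Y. G (J (a \<otimes>\<^sub>\<complex> m) (L Y Z))",
        OF clinear_compose[OF GJ_lin(1) R_lin(2)] clinear_compose[OF GJ_lin(2) L_lin(1)]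
          pure_left_mid] .
  have balanced: "G (J (R X Y) Z) = G (J X (L Y Z))" for X Y Z
    using clinear_tensor_eqI[where F = "\<lambda>X. G (J (R X Y) Z)" and G = "\<lambda>X. G (J X (L Y Z))",
        OF clinear_compose[OF GJ_lin(1) R_lin(1)] GJ_lin(1) pure_left] .
  \<comment> \<open>On a generator of the balancing subspace this is \<open>balanced\<close> with
    \<open>X\<close> and \<open>Z\<close> the coactions of \<open>m\<close> and \<open>k\<close> and
    \<open>Y\<close> the comultiplication of \<open>c\<close>.\<close>
  have GF: "G (F w) = 0" if w: "w \<in> self_balancing M" for w
  proof (rule clinear_zero_on_span[OF clinear_compose[OF G_lin F_lin]])
    show "G (F v) = 0" if v_in: "v \<in> {ract M m c \<otimes>\<^sub>\<complex> k - m \<otimes>\<^sub>\<complex> lact M c k | m c k. True}" for v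
    proof -
      obtain m c k where "v = ract M m c \<otimes>\<^sub>\<complex> k - m \<otimes>\<^sub>\<complex> lact M c k"
        using v_in by blast
      then show ?thesis
        by (simp only: clinear_diff[OF G_lin] clinear_diff[OF F_lin] F_tensor lcoact_ract lcoact_lact
            R_def[symmetric] L_def[symmetric] balanced diff_self)
    qed
  qed (use w in \<open>simp only: balancing_def\<close>)
  \<comment> \<open>Letting \<open>c\<close> act on the module leg of \<open>X\<close> amounts to
    letting it act on \<open>n\<close>; hence \<open>G\<close> kills the generators of
    \<open>amm_balancing M\<close>.\<close>
  have act: "tensor_lift (\<lambda>(a::'a) m. P m n *\<^sub>C a) (tensor_map id (\<lambda>m. ract M m c) X)
      = tensor_lift (\<lambda>a m. P m (lact M c n) *\<^sub>C a) X" for n c X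
  proof (rule clinear_tensor_eqI)
    have T: "clinear (tensor_map id (\<lambda>m. ract M m c))"
      by (intro clinear_tensor_map clinear_id bimodule_linear bimodule)
    show "clinear (\<lambda>X. tensor_lift (\<lambda>(a::'a) m. P m n *\<^sub>C a) (tensor_map id (\<lambda>m. ract M m c) X))"
      by (rule clinear_compose[OF clinear_tensor_lift[OF P_scale(1)] T])
    show "clinear (tensor_lift (\<lambda>(a::'a) m. P m (lact M c n) *\<^sub>C a))"
      by (rule clinear_tensor_lift[OF P_scale(1)])
    show "tensor_lift (\<lambda>(a::'a) m. P m n *\<^sub>C a) (tensor_map id (\<lambda>m. ract M m c) (a \<otimes>\<^sub>\<complex> m))
        = tensor_lift (\<lambda>(a::'a) m. P m (lact M c n) *\<^sub>C a) (a \<otimes>\<^sub>\<complex> m)" for a m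
      by (simp only: tensor_map_tensor[OF clinear_id bimodule_linear(4)[OF bimodule]]
          tensor_lift_tensor[OF P_scale(1)] P_balanced id_apply)
  qed
  have GW: "G w = 0" if w: "w \<in> amm_balancing M" for w
  proof (rule clinear_zero_on_span[OF G_lin])
    show "G v = 0" if v_in: "v \<in> {tensor_map id (\<lambda>m. ract M m c) X \<otimes>\<^sub>\<complex> k - X \<otimes>\<^sub>\<complex> lact M c k
      | X c k. True}" for v
    proof -
      obtain X c k where "v = tensor_map id (\<lambda>m. ract M m c) X \<otimes>\<^sub>\<complex> k - X \<otimes>\<^sub>\<complex> lact M c k"
        using v_in by blast
      then show ?thesis
        by (simp only: clinear_diff[OF G_lin] G_tensor act diff_self)
    qed
  qed (use w in \<open>simp only: amm_balancing_def balancing_def\<close>)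
  have const: "G z = G (F (x \<otimes>\<^sub>\<complex> y))" if z: "z \<in> tensorA_lcoact M (tensorA M x y)" for z
  proof -
    obtain w w' where "w \<in> self_balancing M" "w' \<in> amm_balancing M" "z = F (x \<otimes>\<^sub>\<complex> y + w) + w'"
      using z unfolding tensorA_lcoact_def tensorA_def coset_map_def F_def[unfolded J_def, symmetric]
      by (auto simp only: elt_set_plus_def set_plus_def)
    then show ?thesis
      by (simp only: clinear_add[OF F_lin] clinear_add[OF G_lin] GF GW add_0_right)
  qed
  \<comment> \<open>\<open>the_elem\<close> requires a genuine singleton, so constancy of
    \<open>G\<close> on the coset is not enough without a member of it.\<close>
  have nonempty: "tensorA_lcoact M (tensorA M x y) \<noteq> {}"
  proof -
    have "0 \<in> self_balancing M" "0 \<in> amm_balancing M"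
      by (simp_all only: balancing_def amm_balancing_def complex_vector.span_zero)
    then have "F (x \<otimes>\<^sub>\<complex> y + 0) + 0 \<in> F ` (x \<otimes>\<^sub>\<complex> y +o self_balancing M) + amm_balancing M"
      by (intro set_plus_intro imageI set_plus_intro2)
    then show ?thesis
      unfolding tensorA_lcoact_def tensorA_def coset_map_def F_def[unfolded J_def, symmetric] by blast
  qed
  have "G ` tensorA_lcoact M (tensorA M x y)
      = (\<lambda>_. G (F (x \<otimes>\<^sub>\<complex> y))) ` tensorA_lcoact M (tensorA M x y)"
    using const by (rule image_cong[OF refl])
  also have "\<dots> = {G (F (x \<otimes>\<^sub>\<complex> y))}"
    using nonempty by (simp only: image_constant_conv if_False)
  finally have "the_elem (G ` tensorA_lcoact M (tensorA M x y)) = G (F (x \<otimes>\<^sub>\<complex> y))"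
    by (simp only: the_elem_eq)
  moreover have "the_elem (G ` tensorA_lcoact M (tensorA M x y)) = pairing x y"
    using invariant[unfolded left_invariant_def id_tensor_functional_def, rule_format, of x y]
    unfolding G_def P_def pairing_def .
  \<comment> \<open>Both coactions are 1 tensored with the element itself, which makes the algebra
    leg \<open>1 * 1\<close>.\<close>
  moreover have "F (x \<otimes>\<^sub>\<complex> y) = ((1 * 1) \<otimes>\<^sub>\<complex> x) \<otimes>\<^sub>\<complex> y"
    using x y by (simp only: F_tensor left_inv_def mem_Collect_eq J_tensor)
  ultimately have "pairing x y = P x y *\<^sub>C 1"
    by (simp only: G_tensor' mult_1_left)
  then show ?thesis
    unfolding scalars_def by (rule range_eqI)
qed

end

section \<open>Nondegenerate pairings and their Gram matrices\<close>

text \<open>Rests on \<open>1 \<noteq> 0\<close> in the algebra, and makes \<open>scalar_of\<close>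
  well defined on \<open>scalars\<close>.\<close>

lemma scaleC_one_eq_iff: "c *\<^sub>C (1 :: 'a::complex_algebra_1) = d *\<^sub>C 1 \<longleftrightarrow> c = d"
  using complex_vector.scale_cancel_right[of c "1::'a" d] by simp

lemma scalar_of_scaleC_one [simp]: "scalar_of (c *\<^sub>C (1 :: 'a::complex_algebra_1)) = c"
  unfolding scalar_of_def by (auto simp: scaleC_one_eq_iff)

text \<open>Transfers matrix identities over the complex numbers to the algebra through
  \<open>map_mat\<close>.\<close>

interpretation scaleC_one: semiring_hom "\<lambda>c. c *\<^sub>C (1 :: 'a::complex_algebra_1)"
  by unfold_locales
    (simp_all add: scaleC_add_left scaleC_one mult_scaleC_left mult_scaleC_right scaleC_scaleC)

lemma span_image_expand:
  assumes "finite I" "inj_on \<omega> I" "x \<in> complex_vector.span (\<omega> ` I)"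
  obtains c where "x = (\<Sum>i\<in>I. c i *\<^sub>C \<omega> i)"
proof -
  obtain u where "x = (\<Sum>v\<in>\<omega> ` I. u v *\<^sub>C v)"
    using assms(3) unfolding complex_vector.span_finite[OF finite_imageI[OF assms(1)]] by blast
  then have "x = (\<Sum>i\<in>I. u (\<omega> i) *\<^sub>C \<omega> i)"
    by (simp add: sum.reindex[OF assms(2)])
  then show thesis by (rule that)
qed

text \<open>\<open>scalar\<close> and \<open>generated\<close> collect what the coactions and the
  multiplication isomorphisms contribute; the consequences drawn inside the locale are linear
  algebra.\<close>

locale nondegenerate_pairing = right_linear_pairing M g
  for M :: "('a::complex_algebra_1, 'm::complex_vector) bimod_data"
    and g :: "('m, 'm) tensor set \<Rightarrow> 'a" +
  fixes n :: nat and \<omega> :: "nat \<Rightarrow> 'm"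
  assumes nondegenerate: "\<And>x. (\<And>y. pairing x y = 0) \<Longrightarrow> x = 0"
    and scalar: "\<And>x y. x \<in> left_inv M \<Longrightarrow> y \<in> left_inv M \<Longrightarrow> pairing x y \<in> scalars"
    and generated: "\<And>x. \<exists>a. x = (\<Sum>j<n. ract M (\<omega> j) (a j))"
    and basis: "inj_on \<omega> {..<n}" "complex_vector.independent (\<omega> ` {..<n})"
      "complex_vector.span (\<omega> ` {..<n}) = left_inv M"
begin

section \<open>Coordinates with respect to the basis of left-invariant elements\<close>

lemma basis_in_left_inv: "i < n \<Longrightarrow> \<omega> i \<in> left_inv M"
  unfolding basis(3)[symmetric] by (rule complex_vector.span_base) simp

lemma left_inv_subspace: "complex_vector.subspace (left_inv M)"
  unfolding basis(3)[symmetric] by (rule complex_vector.subspace_span)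

lemma left_inv_sum: "(\<Sum>i<n. c i *\<^sub>C \<omega> i) \<in> left_inv M"
  by (intro complex_vector.subspace_sum complex_vector.subspace_scale left_inv_subspace
      basis_in_left_inv) simp

lemma left_inv_expand:
  assumes "x \<in> left_inv M"
  obtains c where "x = (\<Sum>i<n. c i *\<^sub>C \<omega> i)"
  using span_image_expand[OF finite_lessThan basis(1)] assms basis(3) by metis

lemma basis_coefficients_zero:
  assumes "(\<Sum>i<n. c i *\<^sub>C \<omega> i) = 0" "i < n"
  shows "c i = 0"
proof -
  \<comment> \<open>Independence speaks of coefficients attached to vectors, so the indexed ones are
    transported along the inverse of \<open>\<omega>\<close>.\<close>
  let ?u = "c \<circ> inv_into {..<n} \<omega>"
  have "(\<Sum>v\<in>\<omega> ` {..<n}. ?u v *\<^sub>C v) = 0"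
    using assms(1) by (simp add: sum.reindex[OF basis(1)] inv_into_f_f[OF basis(1)])
  moreover have "\<omega> i \<in> \<omega> ` {..<n}" using assms(2) by simp
  ultimately have "?u (\<omega> i) = 0"
    using basis(2) complex_vector.dependent_finite[of "\<omega> ` {..<n}"] by blast
  then show ?thesis
    using assms(2) by (simp add: inv_into_f_f[OF basis(1)])
qed

text \<open>Every \<open>y\<close> is a sum of terms \<open>ract M (\<omega> j) (a j)\<close>, so
  right linearity spreads the vanishing to all \<open>y\<close> and nondegeneracy applies.\<close>

lemma left_orthogonal_basis_zero:
  assumes "\<And>j. j < n \<Longrightarrow> pairing x (\<omega> j) = 0"
  shows "x = 0"
proof (rule nondegenerate)
  fix y
  obtain a where "y = (\<Sum>j<n. ract M (\<omega> j) (a j))" using generated by blast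
  then show "pairing x y = 0"
    by (simp add: pairing_sum_right pairing_ract assms)
qed

section \<open>The Gram matrix and its inverse\<close>

definition gram :: "complex mat"
  where "gram = mat n n (\<lambda>(i, j). scalar_of (pairing (\<omega> i) (\<omega> j)))"

lemma gram_carrier: "gram \<in> carrier_mat n n"
  by (simp add: gram_def)

lemma pairing_basis: "i < n \<Longrightarrow> j < n \<Longrightarrow> pairing (\<omega> i) (\<omega> j) = gram $$ (i, j) *\<^sub>C 1"
  using scalar[OF basis_in_left_inv basis_in_left_inv, of i j]
  by (auto simp: gram_def scalars_def)

lemma metric_matrix_gram: "metric_matrix M g n \<omega> = map_mat (\<lambda>c. c *\<^sub>C 1) gram"
  by (rule eq_matI) (simp_all add: metric_matrix_def carrier_matD[OF gram_carrier] pairing_basis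
      flip: pairing_def)

text \<open>Inverting over the complex numbers makes determinants available, as the algebra may be
  noncommutative. A vector \<open>v\<close> killed by the transpose gives a combination of the basis
  orthogonal, in the first argument, to every \<open>\<omega> j\<close>; it is 0, and so is
  \<open>v\<close>.\<close>

lemma gram_inverse:
  obtains B where "B \<in> carrier_mat n n" "gram * B = 1\<^sub>m n" "B * gram = 1\<^sub>m n"
proof -
  have "det (transpose_mat gram) \<noteq> 0"
  proof
    assume "det (transpose_mat gram) = 0"
    then obtain v where v: "v \<in> carrier_vec n" "v \<noteq> 0\<^sub>v n" "transpose_mat gram *\<^sub>v v = 0\<^sub>v n"
      using det_0_iff_vec_prod_zero_field[of "transpose_mat gram" n] gram_carrier by auto
    have "(\<Sum>i<n. gram $$ (i, j) * v $ i) = 0" if "j < n" for j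
    proof -
      have "(transpose_mat gram *\<^sub>v v) $ j = 0" using v(3) that by simp
      then show ?thesis
        using that v(1) gram_carrier by (simp add: scalar_prod_def lessThan_atLeast0)
    qed
    then have "pairing (\<Sum>i<n. v $ i *\<^sub>C \<omega> i) (\<omega> j) = 0" if "j < n" for j
      using that
      by (simp add: pairing_sum_left pairing_scale_left pairing_basis scaleC_scaleC mult.commute
          flip: complex_vector.scale_sum_left)
    then have "(\<Sum>i<n. v $ i *\<^sub>C \<omega> i) = 0"
      by (rule left_orthogonal_basis_zero)
    then have "v $ i = 0" if "i < n" for i
      using basis_coefficients_zero that by blast
    then have "v = 0\<^sub>v n"
      using v(1) by (intro eq_vecI) auto
    with v(2) show False ..
  qed
  then have "det gram \<noteq> 0"
    by (simp add: det_transpose[OF gram_carrier])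
  \<comment> \<open>Being a unit of the matrix ring supplies both inverse identities;
    \<open>()\<close> only fills the extension slot of the ring record.\<close>
  from det_non_zero_imp_unit[OF gram_carrier this, of "()"] show thesis
    using that by (auto simp: Units_def ring_mat_def)
qed

lemma gram_inverse_map:
  obtains B where "B \<in> carrier_mat n n"
    "metric_matrix M g n \<omega> * map_mat (\<lambda>c. c *\<^sub>C 1) B = 1\<^sub>m n"
    "map_mat (\<lambda>c. c *\<^sub>C 1) B * metric_matrix M g n \<omega> = 1\<^sub>m n"
proof -
  obtain B where B: "B \<in> carrier_mat n n" "gram * B = 1\<^sub>m n" "B * gram = 1\<^sub>m n"
    by (rule gram_inverse)
  show thesis
  proof (rule that[OF B(1)])
    show "metric_matrix M g n \<omega> * map_mat (\<lambda>c. c *\<^sub>C 1) B = 1\<^sub>m n"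
      unfolding metric_matrix_gram
      by (simp add: B(2) scaleC_one.mat_hom_one flip: scaleC_one.mat_hom_mult[OF gram_carrier B(1)])
    show "map_mat (\<lambda>c. c *\<^sub>C 1) B * metric_matrix M g n \<omega> = 1\<^sub>m n"
      unfolding metric_matrix_gram
      by (simp add: B(3) scaleC_one.mat_hom_one flip: scaleC_one.mat_hom_mult[OF B(1) gram_carrier])
  qed
qed

lemma metric_matrix_carrier: "metric_matrix M g n \<omega> \<in> carrier_mat n n"
  by (simp add: metric_matrix_def)

lemma metric_matrix_invertible: "invertible_mat (metric_matrix M g n \<omega>)"
proof -
  obtain B where "B \<in> carrier_mat n n"
    "metric_matrix M g n \<omega> * map_mat (\<lambda>c. c *\<^sub>C 1) B = 1\<^sub>m n"
    "map_mat (\<lambda>c. c *\<^sub>C 1) B * metric_matrix M g n \<omega> = 1\<^sub>m n"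
    by (rule gram_inverse_map)
  then show ?thesis
    using metric_matrix_carrier unfolding invertible_mat_def inverts_mat_def
    by (intro conjI exI[of _ "map_mat (\<lambda>c. c *\<^sub>C 1) B"]) auto
qed

text \<open>Inverses are unique: the left inverse \<open>C\<close> agrees with the right inverse
  that comes from a complex matrix.\<close>

lemma metric_matrix_inverse_scalars:
  assumes C: "C \<in> carrier_mat n n" and inv: "inverts_mat C (metric_matrix M g n \<omega>)"
    and ij: "i < n" "j < n"
  shows "C $$ (i, j) \<in> scalars"
proof -
  obtain B where B: "B \<in> carrier_mat n n"
    "metric_matrix M g n \<omega> * map_mat (\<lambda>c. c *\<^sub>C 1) B = 1\<^sub>m n"
    by (rule gram_inverse_map)
  let ?B = "map_mat (\<lambda>c. c *\<^sub>C 1) B :: 'a mat"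
  have B': "?B \<in> carrier_mat n n" using B(1) by simp
  have "C * metric_matrix M g n \<omega> = 1\<^sub>m n"
    using inv C by (simp add: inverts_mat_def)
  then have "?B = (C * metric_matrix M g n \<omega>) * ?B"
    using B' by simp
  also have "\<dots> = C * (metric_matrix M g n \<omega> * ?B)"
    by (rule assoc_mult_mat[OF C metric_matrix_carrier B'])
  also have "\<dots> = C"
    using B(2) C by simp
  finally have "C $$ (i, j) = ?B $$ (i, j)"
    by simp
  then show ?thesis
    using ij B(1) by (simp add: scalars_def)
qed

lemma gram_inverse_sums:
  obtains B where
    "\<And>i j. i < n \<Longrightarrow> j < n \<Longrightarrow> (\<Sum>k<n. B i k * gram $$ (k, j)) = (if i = j then 1 else 0)"
proof -
  obtain B where B: "B \<in> carrier_mat n n" "B * gram = 1\<^sub>m n"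
    by (rule gram_inverse)
  have "(\<Sum>k<n. B $$ (i, k) * gram $$ (k, j)) = (if i = j then 1 else 0)" if "i < n" "j < n" for i j
  proof -
    have "(B * gram) $$ (i, j) = (if i = j then 1 else 0)" using that by (simp add: B(2))
    then show ?thesis
      using that B(1) gram_carrier by (simp add: scalar_prod_def lessThan_atLeast0)
  qed
  then show thesis by (rule that)
qed

text \<open>Nondegeneracy is given in the first argument only, so the second is reached through the
  matrix: applying its complex inverse to the linear system for the coefficients \<open>a j\<close>
  isolates each of them.\<close>

lemma right_orthogonal_basis_zero:
  assumes "\<And>i. i < n \<Longrightarrow> pairing (\<omega> i) x = 0"
  shows "x = 0"
proof -
  obtain B where B: "\<And>i j. i < n \<Longrightarrow> j < n \<Longrightarrow>
      (\<Sum>k<n. B i k * gram $$ (k, j)) = (if i = j then 1 else 0)"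
    by (rule gram_inverse_sums) blast
  obtain a where a: "x = (\<Sum>j<n. ract M (\<omega> j) (a j))" using generated by blast
  have ga: "(\<Sum>j<n. gram $$ (k, j) *\<^sub>C a j) = 0" if "k < n" for k
    using assms[OF that] that by (simp add: a pairing_sum_right pairing_ract pairing_basis
        mult_scaleC_left)
  have "a i = 0" if "i < n" for i
  proof -
    have "0 = (\<Sum>k<n. B i k *\<^sub>C (\<Sum>j<n. gram $$ (k, j) *\<^sub>C a j))"
      by (simp add: ga)
    also have "\<dots> = (\<Sum>k<n. \<Sum>j<n. (B i k * gram $$ (k, j)) *\<^sub>C a j)"
      by (simp add: complex_vector.scale_sum_right scaleC_scaleC)
    also have "\<dots> = (\<Sum>j<n. (\<Sum>k<n. B i k * gram $$ (k, j)) *\<^sub>C a j)"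
      by (subst sum.swap) (simp add: complex_vector.scale_sum_left)
    also have "\<dots> = (\<Sum>j<n. if j = i then a j else 0)"
      by (intro sum.cong) (auto simp: B[OF that] scaleC_one)
    also have "\<dots> = a i"
      using that by simp
    finally show ?thesis by simp
  qed
  then show ?thesis
    by (simp add: a clinear_zero[OF bimodule_linear(3)[OF bimodule]])
qed

section \<open>The induced map from the left-invariant elements to their dual\<close>

lemma metric_map_inv_apply:
  "x \<in> left_inv M \<Longrightarrow> y \<in> left_inv M \<Longrightarrow> pairing x y = metric_map_inv M g x y *\<^sub>C 1"
  using scalar[of x y]
  by (auto simp: metric_map_inv_def metric_map_def scalars_def simp flip: pairing_def)

lemma metric_map_inv_outside: "y \<notin> left_inv M \<Longrightarrow> metric_map_inv M g x y = undefined"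
  by (simp add: metric_map_inv_def)

lemma metric_map_inv_eqI:
  "x \<in> left_inv M \<Longrightarrow> y \<in> left_inv M \<Longrightarrow> pairing x y = c *\<^sub>C 1 \<Longrightarrow> metric_map_inv M g x y = c"
  by (simp add: metric_map_inv_apply scaleC_one_eq_iff)

lemma metric_map_inv_add:
  assumes "x \<in> left_inv M" "y \<in> left_inv M"
  shows "metric_map_inv M g (x + y)
    = (\<lambda>f\<in>left_inv M. metric_map_inv M g x f + metric_map_inv M g y f)"
proof
  fix f
  show "metric_map_inv M g (x + y) f
      = (\<lambda>f\<in>left_inv M. metric_map_inv M g x f + metric_map_inv M g y f) f"
    using assms
    by (cases "f \<in> left_inv M")
      (auto simp: metric_map_inv_outside pairing_add_left metric_map_inv_apply scaleC_add_left
        complex_vector.subspace_add[OF left_inv_subspace] intro!: metric_map_inv_eqI)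
qed

lemma metric_map_inv_scale:
  assumes "x \<in> left_inv M"
  shows "metric_map_inv M g (c *\<^sub>C x) = (\<lambda>f\<in>left_inv M. c * metric_map_inv M g x f)"
proof
  fix f
  show "metric_map_inv M g (c *\<^sub>C x) f = (\<lambda>f\<in>left_inv M. c * metric_map_inv M g x f) f"
    using assms
    by (cases "f \<in> left_inv M")
      (auto simp: metric_map_inv_outside pairing_scale_left metric_map_inv_apply scaleC_scaleC
        complex_vector.subspace_scale[OF left_inv_subspace] intro!: metric_map_inv_eqI)
qed

lemma metric_map_inv_in_dual:
  assumes "x \<in> left_inv M"
  shows "metric_map_inv M g x \<in> subspace_dual (left_inv M)"
  unfolding subspace_dual_def
  using assms
  by (auto simp: metric_map_inv_outside pairing_add_right pairing_scale_right metric_map_inv_apply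
      scaleC_add_left scaleC_scaleC complex_vector.subspace_scale[OF left_inv_subspace]
      complex_vector.subspace_add[OF left_inv_subspace] extensional_def intro!: metric_map_inv_eqI)

text \<open>Members of \<open>subspace_dual\<close> are linear only on the subspace, so the
  induction over \<open>I\<close> must keep the partial sums inside it.\<close>

lemma subspace_dual_sum:
  assumes "\<phi> \<in> subspace_dual (left_inv M)" "I \<subseteq> {..<n}"
  shows "\<phi> (\<Sum>i\<in>I. c i *\<^sub>C \<omega> i) = (\<Sum>i\<in>I. c i * \<phi> (\<omega> i))"
proof -
  have "0 \<in> left_inv M"
    by (rule complex_vector.subspace_0[OF left_inv_subspace])
  with assms(1) have "\<phi> (0 + 0) = \<phi> 0 + \<phi> 0"
    unfolding subspace_dual_def by blast
  then have zero: "\<phi> 0 = 0" by simp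
  have "finite I" using assms(2) by (rule finite_subset) simp
  then show ?thesis
    using assms(2)
  proof (induction I)
    case empty
    show ?case by (simp add: zero)
  next
    case (insert i I)
    have "\<omega> i \<in> left_inv M"
      using insert.prems basis_in_left_inv by simp
    moreover have "(\<Sum>i\<in>I. c i *\<^sub>C \<omega> i) \<in> left_inv M"
      using insert.prems basis_in_left_inv
      by (intro complex_vector.subspace_sum complex_vector.subspace_scale left_inv_subspace) auto
    ultimately show ?case
      using insert assms(1) complex_vector.subspace_scale[OF left_inv_subspace]
      by (simp add: subspace_dual_def)
  qed
qed

lemma subspace_dual_eqI:
  assumes "\<phi> \<in> subspace_dual (left_inv M)" "\<psi> \<in> subspace_dual (left_inv M)"
    and "\<And>i. i < n \<Longrightarrow> \<phi> (\<omega> i) = \<psi> (\<omega> i)"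
  shows "\<phi> = \<psi>"
proof (rule extensionalityI)
  show "\<phi> \<in> extensional (left_inv M)" "\<psi> \<in> extensional (left_inv M)"
    using assms(1,2) by (simp_all add: subspace_dual_def)
  fix x assume "x \<in> left_inv M"
  then obtain c where "x = (\<Sum>i<n. c i *\<^sub>C \<omega> i)" by (rule left_inv_expand)
  then show "\<phi> x = \<psi> x"
    by (simp add: subspace_dual_sum assms)
qed

text \<open>Injectivity is nondegeneracy tested on the basis; surjectivity comes from an explicit
  preimage built with the inverse Gram matrix.\<close>

lemma metric_map_inv_bij:
  "bij_betw (metric_map_inv M g) (left_inv M) (subspace_dual (left_inv M))"
proof (rule bij_betw_imageI)
  show "inj_on (metric_map_inv M g) (left_inv M)"
  proof (rule inj_onI)
    fix x y
    assume xy: "x \<in> left_inv M" "y \<in> left_inv M" "metric_map_inv M g x = metric_map_inv M g y"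
    have "pairing (x - y) (\<omega> j) = 0" if "j < n" for j
      using xy that
      by (simp add: pairing_diff_left metric_map_inv_apply basis_in_left_inv)
    then show "x = y"
      using left_orthogonal_basis_zero[of "x - y"] by simp
  qed
next
  have "\<phi> \<in> metric_map_inv M g ` left_inv M" if \<phi>: "\<phi> \<in> subspace_dual (left_inv M)" for \<phi>
  proof -
    obtain B where B: "\<And>i j. i < n \<Longrightarrow> j < n \<Longrightarrow>
        (\<Sum>k<n. B i k * gram $$ (k, j)) = (if i = j then 1 else 0)"
      by (rule gram_inverse_sums) blast
    \<comment> \<open>The coefficients form the row vector of values
      \<open>\<phi> (\<omega> i)\<close> times the inverse matrix; pairing with
      \<open>\<omega> j\<close> multiplies by the Gram matrix and returns
      \<open>\<phi> (\<omega> j)\<close>.\<close>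
    define x where "x = (\<Sum>k<n. (\<Sum>i<n. \<phi> (\<omega> i) * B i k) *\<^sub>C \<omega> k)"
    have x: "x \<in> left_inv M"
      unfolding x_def by (rule left_inv_sum)
    have "metric_map_inv M g x (\<omega> j) = \<phi> (\<omega> j)" if j: "j < n" for j
    proof (rule metric_map_inv_eqI[OF x basis_in_left_inv[OF j]])
      have "(\<Sum>k<n. (\<Sum>i<n. \<phi> (\<omega> i) * B i k) * gram $$ (k, j))
          = (\<Sum>i<n. \<phi> (\<omega> i) * (\<Sum>k<n. B i k * gram $$ (k, j)))"
        unfolding sum_distrib_left sum_distrib_right mult.assoc by (rule sum.swap)
      also have "\<dots> = \<phi> (\<omega> j)"
        using j by (simp add: B if_distrib sum.delta cong: if_cong)
      finally show "pairing x (\<omega> j) = \<phi> (\<omega> j) *\<^sub>C 1"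
        using j by (simp add: x_def pairing_sum_left pairing_scale_left pairing_basis scaleC_scaleC
            flip: complex_vector.scale_sum_left)
    qed
    then have "metric_map_inv M g x = \<phi>"
      by (intro subspace_dual_eqI metric_map_inv_in_dual x \<phi>)
    then show ?thesis
      using x by blast
  qed
  then show "metric_map_inv M g ` left_inv M = subspace_dual (left_inv M)"
    using metric_map_inv_in_dual by blast
qed

end

text \<open>The multiplication map is onto, so it suffices to treat its arguments by induction over
  the span of pure tensors, expanding each invariant factor in the basis.\<close>

lemma ract_generated:
  fixes n :: nat
  assumes bimodule: "bimodule M"
    and onto: "tensor_lift (ract M) ` tensor_of_subspaces (left_inv M) UNIV = UNIV"
    and span: "complex_vector.span (\<omega> ` {..<n}) = left_inv M" and inj: "inj_on \<omega> {..<n}"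
  shows "\<exists>a. x = (\<Sum>j<n. ract M (\<omega> j) (a j))"
proof -
  note lin = bimodule_linear[OF bimodule]
  obtain t where t: "t \<in> tensor_of_subspaces (left_inv M) UNIV" and x: "x = tensor_lift (ract M) t"
    using onto by (metis UNIV_I imageE)
  have "\<exists>a. tensor_lift (ract M) t = (\<Sum>j<n. ract M (\<omega> j) (a j))"
    using t unfolding tensor_of_subspaces_def
  proof (induction rule: complex_vector.span_induct_alt)
    case base
    have "tensor_lift (ract M) 0 = (\<Sum>j<n. ract M (\<omega> j) 0)"
      by (simp add: clinear_zero[OF clinear_tensor_lift] clinear_zero[OF lin(3)] lin)
    then show ?case by (rule exI[of _ "\<lambda>_. 0"])
  next
    case (step c s t)
    then obtain a where a: "tensor_lift (ract M) t = (\<Sum>j<n. ract M (\<omega> j) (a j))" by blast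
    from step(1) obtain u b where s: "s = u \<otimes>\<^sub>\<complex> b" and u_in: "u \<in> left_inv M" by blast
    obtain w where u: "u = (\<Sum>j<n. w j *\<^sub>C \<omega> j)"
      using span_image_expand[OF finite_lessThan inj] u_in span by metis
    \<comment> \<open>The complex coefficients of the invariant factor are moved into the algebra
      factor.\<close>
    have "ract M (\<Sum>j\<in>J. w j *\<^sub>C \<omega> j) b = (\<Sum>j\<in>J. ract M (\<omega> j) (w j *\<^sub>C b))" for J
      by (induction J rule: infinite_finite_induct)
        (simp_all add: clinear_zero[OF lin(4)] clinear_add[OF lin(4)]
          clinear_scale[OF lin(4)] clinear_scale[OF lin(3)])
    then have "tensor_lift (ract M) (c *\<^sub>C s + t)
        = (\<Sum>j<n. ract M (\<omega> j) (c *\<^sub>C w j *\<^sub>C b + a j))"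
      by (simp add: clinear_add[OF clinear_tensor_lift] clinear_scale[OF clinear_tensor_lift]
          clinear_add[OF lin(3)] clinear_scale[OF lin(3)] tensor_lift_tensor lin
          a s u sum.distrib complex_vector.scale_sum_right)
    then show ?case by (rule exI[of _ "\<lambda>j. c *\<^sub>C w j *\<^sub>C b + a j"])
  qed
  then show ?thesis by (simp add: x)
qed

section \<open>Derivation of the five claims from the properties of the pairing\<close>

theorem proposition3p6:
  fixes H :: "'a::complex_algebra_1 hopf_data"
    and E :: "('a, 'e::complex_vector) bimod_data"
    and \<sigma> :: "('e, 'e) tensor set \<Rightarrow> ('e, 'e) tensor set"
    and g :: "('e, 'e) tensor set \<Rightarrow> 'a"
    and n :: nat
    and \<omega> :: "nat \<Rightarrow> 'e"
  assumes hopf: "hopf_algebra H"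
    and bicovariant: "bicovariant_bimodule H E"
    and finite: "finite_bimodule E"
    and isos: "multiplication_isos E"
    and braiding: "is_braiding E \<sigma>"
    and metric: "pseudo_riemannian_metric E \<sigma> g"
    and invariant: "left_invariant H E g"
    and basis: "inj_on \<omega> {..<n}" "complex_vector.independent (\<omega> ` {..<n})"
      "complex_vector.span (\<omega> ` {..<n}) = left_inv E"
  shows
    \<comment> \<open>(i)\<close>
    "(inj (metric_map E g) \<and> range (metric_map E g) \<subseteq> right_dual E \<and>
      (\<forall>x y. metric_map E g (x + y) = (\<lambda>f. metric_map E g x f + metric_map E g y f)) \<and>
      (\<forall>e a. metric_map E g (ract E e a) = dual_ract E (metric_map E g e) a)) \<and>
    \<comment> \<open>(ii)\<close>
    (\<forall>e. (\<forall>f\<in>left_inv E. g (tensorA E e f) = 0) \<longrightarrow> e = 0) \<and>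
    ((\<forall>e\<in>left_inv E. \<forall>f\<in>left_inv E. metric_map E g e f \<in> scalars) \<and>
      inj_on (metric_map E g) (left_inv E) \<and>
      bij_betw (metric_map_inv E g) (left_inv E) (subspace_dual (left_inv E)) \<and>
      (\<forall>x\<in>left_inv E. \<forall>y\<in>left_inv E. metric_map_inv E g (x + y)
        = (\<lambda>f\<in>left_inv E. metric_map_inv E g x f + metric_map_inv E g y f)) \<and>
      (\<forall>c. \<forall>x\<in>left_inv E. metric_map_inv E g (c *\<^sub>C x)
        = (\<lambda>f\<in>left_inv E. c * metric_map_inv E g x f))) \<and>
    \<comment> \<open>(iii)\<close>
    invertible_mat (metric_matrix E g n \<omega>) \<and>
    \<comment> \<open>(iv)\<close>
    (\<forall>B\<in>carrier_mat n n.
      inverts_mat (metric_matrix E g n \<omega>) B \<and> inverts_mat B (metric_matrix E g n \<omega>) \<longrightarrow>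
      (\<forall>i<n. \<forall>j<n. B $$ (i, j) \<in> scalars)) \<and>
    \<comment> \<open>(v)\<close>
    (\<forall>f. (\<forall>e\<in>left_inv E. g (tensorA E e f) = 0) \<longrightarrow> f = 0)"
proof -
  interpret right_linear_pairing E g
    using bicovariant metric
    by unfold_locales (simp_all add: bicovariant_bimodule_def pseudo_riemannian_metric_def)
  have scalar: "pairing x y \<in> scalars" if "x \<in> left_inv E" "y \<in> left_inv E" for x y
    using hopf bicovariant invariant that
    by (intro invariant_pairing_scalar[of H])
      (simp_all add: hopf_algebra_def bicovariant_bimodule_def left_comodule_def)
  interpret nondegenerate_pairing E g n \<omega>
  proof unfold_locales
    show "x = 0" if "\<And>y. pairing x y = 0" for x
      using metric that by (simp add: pseudo_riemannian_metric_def pairing_def)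
    \<comment> \<open>Generation is the surjectivity of right multiplication from left-invariant
      elements tensored with the algebra.\<close>
    show "\<exists>a. x = (\<Sum>j<n. ract E (\<omega> j) (a j))" for x
      using isos basis bimodule
      by (intro ract_generated) (simp_all add: multiplication_isos_def bij_betw_def)
  qed (fact scalar basis)+
  have V: "metric_map E g = pairing"
    by (intro ext) (simp add: metric_map_def pairing_def)
  have inj: "inj (metric_map E g)"
    unfolding V
  proof (rule injI)
    fix x y assume "pairing x = pairing y"
    then have "pairing (x - y) z = 0" for z
      by (simp add: pairing_diff_left)
    then show "x = y"
      using nondegenerate[of "x - y"] by simp
  qed
  show ?thesis
    unfolding V pairing_def[symmetric]
  proof (intro conjI allI ballI impI)
    show "inj pairing" "inj_on pairing (left_inv E)"
      using inj by (auto simp: V inj_on_def)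
    show "range pairing \<subseteq> right_dual E"
      by (auto simp: right_dual_def pairing_add_right pairing_ract)
    show "pairing (x + y) = (\<lambda>f. pairing x f + pairing y f)" for x y
      by (rule ext) (rule pairing_add_left)
    show "pairing (ract E e a) = dual_ract E (pairing e) a" for e a
      by (auto simp: dual_ract_def pairing_balanced)
    show "e = 0" if "\<forall>f\<in>left_inv E. pairing e f = 0" for e
      using that by (intro left_orthogonal_basis_zero) (simp add: basis_in_left_inv)
    show "f = 0" if "\<forall>e\<in>left_inv E. pairing e f = 0" for f
      using that by (intro right_orthogonal_basis_zero) (simp add: basis_in_left_inv)
  qed (auto intro: scalar metric_map_inv_bij metric_map_inv_add metric_map_inv_scale
      metric_matrix_invertible metric_matrix_inverse_scalars)
qed

end
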